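(* Let $(X,\nu)$ be a continuous (non-atomic) Lebesgue space with finite measure, $\alpha$ the Gaussian white noise on $(X,\nu)$ and $\pi$ the Poisson process on $(X,\nu)$. Let $\Phi:L^2(\alpha)\to L^2(\pi)$ be the canonical isometry, determined by $$\Phi\big(e^{\langle h,\cdot\rangle-\frac{\|h\|^2}{2}}\big)(\omega)=\prod_{x\in\omega}(1+h(x))\cdot e^{-\int_Xh\,d\nu},\qquad h\in L^2(X,\nu)\ \text{real-valued}.$$ Then for every $n\ge1$ and all $f_1,\dots,f_n\in L^2(X,\nu)$, $\Phi$ sends the generalized Hermite functional to the corresponding generalized Charlier functional: $$\Phi\,\mathfrak H^{(n)}_{f_1,\dots,f_n}=\mathfrak C^{(n)}_{f_1,\dots,f_n}.$$
   Context: Gaussian white noise $\alpha$ on $(X,\nu)$: the generalized random process on real $L^2(X,\nu)$ with $\mathbb E e^{i\langle h,\cdot\rangle}=e^{-\|h\|^2/2}$. Poisson process $\pi$: a random point configuration $\omega\subset X$ with $\#(\omega\cap A)$ Poisson distributed with parameter $\nu(A)$ and independent for disjoint sets. $L^2(\alpha)$, $L^2(\pi)$ are the complex Hilbert spaces of square integrable functionals of these processes. Functions $f_i$ are real-valued. Let $\mathfrak S_n$ be the symmetric group of degree $n$, $\mathrm{Inv}_n\subset\mathfrak S_n$ the set of involutions (permutations all of whose cycles have length at most two, including the identity), $C_k(g)$ the set of cycles of length $k$ of $g$, and $c(g)$ the total number of cycles of $g$ (fixed points included). Generalized Hermite functional: $$\mathfrak H^{(n)}_{f_1,\dots,f_n}(\cdot)=\sum_{g\in\mathrm{Inv}_n}\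 \prod_{i\in C_1(g)}\langle f_i,\cdot\rangle\prod_{\{j,k\}\in C_2(g)}\big(-(f_j,f_k)\big),\qquad (f_j,f_k)=\int_Xf_jf_k\,d\nu.$$ Generalized Charlier functional: $$\mathfrak C^{(n)}_{f_1,\dots,f_n}(\omega)=\sum_{g\in\mathfrak S_n}(-1)^{n-c(g)}\prod_{i\in C_1(g)}\Big(\sum_{x\in\omega}f_i(x)-\int_Xf_i\,d\nu\Big)\prod_{k\ge2}\ \prod_{(i_1\dots i_k)\in C_k(g)}\ \sum_{x\in\omega}f_{i_1}(x)\cdots f_{i_k}(x).$$ *)

theory Defs
  imports "HOL-Probability.Probability" "HOL-Combinatorics.Orbits"
begin

section \<open>Square integrable functions\<close>

text \<open>Elements of an \<open>L\<^sup>2\<close> space are represented by functions; equality of elements is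
  almost everywhere equality of representatives.\<close>

definition L2 :: "'a measure \<Rightarrow> ('a \<Rightarrow> 'b::{real_normed_vector, second_countable_topology}) set"
  where "L2 M = {f \<in> borel_measurable M. integrable M (\<lambda>x. (norm (f x))\<^sup>2)}"

definition l2_inner :: "'a measure \<Rightarrow> ('a \<Rightarrow> real) \<Rightarrow> ('a \<Rightarrow> real) \<Rightarrow> real"
  where "l2_inner M f g = (\<integral>x. f x * g x \<partial>M)"

text \<open>Complex linear, norm preserving maps from \<open>L\<^sup>2(P)\<close> to \<open>L\<^sup>2(Q)\<close>. Linearity and
  preservation of the norm imply that equivalent representatives have equivalent images.\<close>

definition L2_isometry ::
  "'a measure \<Rightarrow> 'b measure \<Rightarrow> (('a \<Rightarrow> complex) \<Rightarrow> ('b \<Rightarrow> complex)) \<Rightarrow> bool"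
  where "L2_isometry P Q \<Phi> \<longleftrightarrow>
    (\<forall>F \<in> L2 P. \<Phi> F \<in> L2 Q) \<and>
    (\<forall>F \<in> L2 P. \<forall>G \<in> L2 P. \<forall>a b.
       AE y in Q. \<Phi> (\<lambda>x. a * F x + b * G x) y = a * \<Phi> F y + b * \<Phi> G y) \<and>
    (\<forall>F \<in> L2 P. (\<integral>y. (norm (\<Phi> F y))\<^sup>2 \<partial>Q) = (\<integral>x. (norm (F x))\<^sup>2 \<partial>P))"


section \<open>Continuous Lebesgue spaces\<close>

definition mod0_isomorphism ::
  "'a measure \<Rightarrow> 'b measure \<Rightarrow> 'a set \<Rightarrow> 'b set \<Rightarrow> ('a \<Rightarrow> 'b) \<Rightarrow> bool"
  where "mod0_isomorphism M N A B \<phi> \<longleftrightarrow>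
    A \<in> null_sets M \<and> B \<in> null_sets N \<and>
    bij_betw \<phi> (space M - A) (space N - B) \<and>
    \<phi> \<in> measurable (restrict_space M (space M - A)) (restrict_space N (space N - B)) \<and>
    the_inv_into (space M - A) \<phi> \<in>
      measurable (restrict_space N (space N - B)) (restrict_space M (space M - A)) \<and>
    (\<forall>E \<in> sets M. E \<subseteq> space M - A \<longrightarrow> emeasure N (\<phi> ` E) = emeasure M E)"

text \<open>A finite Lebesgue space in the sense of Rokhlin without atoms: a complete measure space
  isomorphic modulo null sets to an interval with Lebesgue measure.\<close>

definition continuous_lebesgue_space :: "'a measure \<Rightarrow> bool"
  where "continuous_lebesgue_space M \<longleftrightarrow>
    finite_measure M \<and> complete_measure M \<and>
    (\<exists>A B \<phi>. mod0_isomorphism M (lebesgue_on {0..measure M (space M)}) A B \<phi>)"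


section \<open>Gaussian white noise and the Poisson process\<close>

text \<open>\<open>W h\<close> is the random variable \<open>\<langle>h, \<cdot>\<rangle>\<close> on the probability space \<open>P\<close>. The \<open>\<sigma>\<close>-algebra
  of \<open>P\<close> is the one generated by the process, so that \<open>L2 P\<close> consists of the square integrable
  functionals of the process.\<close>

definition gaussian_white_noise ::
  "'a measure \<Rightarrow> 'w measure \<Rightarrow> (('a \<Rightarrow> real) \<Rightarrow> 'w \<Rightarrow> real) \<Rightarrow> bool"
  where "gaussian_white_noise M P W \<longleftrightarrow>
    prob_space P \<and>
    sets P = sigma_sets (space P) {W h -` B \<inter> space P | h B. h \<in> L2 M \<and> B \<in> sets borel} \<and>
    (\<forall>g \<in> L2 M. \<forall>h \<in> L2 M. \<forall>a b.
       AE w in P. W (\<lambda>x. a * g x + b * h x) w = a * W g w + b * W h w) \<and>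
    (\<forall>h \<in> L2 M. (\<integral>w. exp (\<i> * complex_of_real (W h w)) \<partial>P)
       = complex_of_real (exp (- l2_inner M h h / 2)))"

text \<open>For a finite intensity measure the configurations of the Poisson process are almost surely
  finite, so the process is realised as a probability measure on the finite subsets of the space;
  its \<open>\<sigma>\<close>-algebra is generated by the counting variables.\<close>

definition configurations :: "'a measure \<Rightarrow> 'a set set"
  where "configurations M = {\<omega>. finite \<omega> \<and> \<omega> \<subseteq> space M}"

definition poisson_process :: "'a measure \<Rightarrow> 'a set measure \<Rightarrow> bool"
  where "poisson_process M Q \<longleftrightarrow>
    prob_space Q \<and>
    space Q = configurations M \<and>
    sets Q = sigma_sets (configurations M)
      {{\<omega> \<in> configurations M. card (\<omega> \<inter> A) = k} | A k. A \<in> sets M} \<and>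
    (\<forall>A \<in> sets M. \<forall>k. measure Q {\<omega> \<in> space Q. card (\<omega> \<inter> A) = k}
       = measure M A ^ k / fact k * exp (- measure M A)) \<and>
    (\<forall>(m::nat) A. (\<forall>i<m. A i \<in> sets M) \<and> disjoint_family_on A {..<m} \<longrightarrow>
       prob_space.indep_vars Q (\<lambda>_. count_space UNIV) (\<lambda>i \<omega>. card (\<omega> \<inter> A i)) {..<m})"


section \<open>Generalized Hermite and Charlier functionals\<close>

text \<open>A cycle of a permutation of \<open>{1..n}\<close> is represented by its support.\<close>

definition cycles :: "nat \<Rightarrow> (nat \<Rightarrow> nat) \<Rightarrow> nat set set"
  where "cycles n g = orbit g ` {1..n}"

definition cycles_of_length :: "nat \<Rightarrow> nat \<Rightarrow> (nat \<Rightarrow> nat) \<Rightarrow> nat set set"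
  where "cycles_of_length n k g = {c \<in> cycles n g. card c = k}"

definition involutions :: "nat \<Rightarrow> (nat \<Rightarrow> nat) set"
  where "involutions n = {g. g permutes {1..n} \<and> (\<forall>c \<in> cycles n g. card c \<le> 2)}"

definition hermite_functional ::
  "'a measure \<Rightarrow> (('a \<Rightarrow> real) \<Rightarrow> 'w \<Rightarrow> real) \<Rightarrow> nat \<Rightarrow> (nat \<Rightarrow> 'a \<Rightarrow> real) \<Rightarrow> 'w \<Rightarrow> real"
  where "hermite_functional M W n f w =
    (\<Sum>g \<in> involutions n.
       (\<Prod>i | {i} \<in> cycles_of_length n 1 g. W (f i) w) *
       (\<Prod>c \<in> cycles_of_length n 2 g. - l2_inner M (f (Min c)) (f (Max c))))"

definition charlier_functional ::
  "'a measure \<Rightarrow> nat \<Rightarrow> (nat \<Rightarrow> 'a \<Rightarrow> real) \<Rightarrow> 'a set \<Rightarrow> real"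
  where "charlier_functional M n f \<omega> =
    (\<Sum>g | g permutes {1..n}.
       (-1) ^ (n - card (cycles n g)) *
       (\<Prod>i | {i} \<in> cycles_of_length n 1 g. (\<Sum>x\<in>\<omega>. f i x) - (\<integral>x. f i x \<partial>M)) *
       (\<Prod>k = 2..n. \<Prod>c \<in> cycles_of_length n k g. \<Sum>x\<in>\<omega>. \<Prod>i\<in>c. f i x))"

end

theory Submission
  imports Defs
begin

text \<open>
  Both functionals are mixed derivatives at \<open>t = 0\<close> of exponential functionals with
  \<open>h = t\<^sub>1 f\<^sub>1 + \<dots> + t\<^sub>n f\<^sub>n\<close>: since inserting an element into a cycle of length \<open>k\<close> is possible in
  \<open>k\<close> ways, differentiating a sum over permutations of products of cycle weights reproduces such a
  sum over one more element. The derivative is approached by the mixed differences over the vertices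
  of the cube \<open>[0, \<epsilon>]\<^sup>n\<close>, divided by \<open>\<epsilon>\<^sup>n\<close>. A mean value theorem bounds them on the Gaussian side by a
  fixed square integrable function, so they converge in \<open>L\<^sup>2\<close> to the Hermite functional, and their
  images under the isometry converge in \<open>L\<^sup>2\<close> to its image. On the Poisson side those images
  are explicit and converge for every finite configuration to the Charlier functional. The two limits
  agree almost everywhere; no moments of the Poisson process are needed.
\<close>

section \<open>Sums over permutations weighted by cycles\<close>

lemma orbit_permutes_eq_iff:
  assumes "g permutes N" "finite N"
  shows "orbit g x = orbit g y \<longleftrightarrow> y \<in> orbit g x"
proof -
  have "permutation g"
    using assms by (auto simp: permutation_permutes)
  then show ?thesis
    using orbit_cyclic_eq3[OF cyclic_on_orbit'] permutation_self_in_orbit by metis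
qed

text \<open>Composing with the transposition reroutes the one arrow of \<open>h\<close> that ends at
  \<open>b\<close>: it now ends at \<open>a\<close>, which is sent on to \<open>b\<close>. So
  \<open>a\<close> enters the cycle of \<open>b\<close> just before \<open>b\<close>, and the other
  cycles inside \<open>N\<close> stay as they are.\<close>

lemma orbit_insert_transpose:
  assumes h: "h permutes N" and "finite N" "a \<notin> N" "b \<in> N" "x \<in> N"
  shows "orbit (Transposition.transpose a b \<circ> h) x = (if b \<in> orbit h x then insert a (orbit h x) else orbit h x)"
proof -
  let ?g = "Transposition.transpose a b \<circ> h"
  have perm: "permutation h"
    using assms by (auto simp: permutation_permutes)
  have "?g permutes insert a N"
    using assms by (intro permutes_compose permutes_swap_id permutes_subset[OF h]) auto
  then have permg: "permutation ?g"
    using assms by (auto simp: permutation_permutes)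
  have ab: "a \<noteq> b" using assms by auto
  have ha: "h a = a" using h \<open>a \<notin> N\<close> by (rule permutes_not_in)
  have hN: "y \<in> N" if "y \<in> orbit h x" for y
    using permutes_orbit_subset[OF h \<open>x \<in> N\<close>] that by auto
  \<comment> \<open>A step of \<open>h\<close> is one step of the new permutation, or two steps
    through \<open>a\<close> when it leads to \<open>b\<close>.\<close>
  have stay: "h y \<in> orbit ?g x" if "y \<in> orbit ?g x" "y \<in> N" for y
  proof (cases "h y = b")
    case True
    then have "?g (?g y) = h y" using ha by simp
    then show ?thesis using orbit.step[OF orbit.step[OF that(1)]] by simp
  next
    case False
    moreover have "h y \<noteq> a" using that h \<open>a \<notin> N\<close> permutes_in_image by metis
    ultimately have "?g y = h y" by (simp add: Transposition.transpose_def)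
    then show ?thesis using orbit.step[OF that(1)] by simp
  qed
  have sub: "orbit h x \<subseteq> orbit ?g x"
  proof
    fix y assume "y \<in> orbit h x"
    then show "y \<in> orbit ?g x"
    proof induct
      case base
      show ?case by (rule stay[OF permutation_self_in_orbit[OF permg] \<open>x \<in> N\<close>])
    next
      case (step y)
      then show ?case by (intro stay hN)
    qed
  qed
  have sub': "orbit ?g x \<subseteq> (if b \<in> orbit h x then insert a (orbit h x) else orbit h x)"
  proof
    fix y assume "y \<in> orbit ?g x"
    then show "y \<in> (if b \<in> orbit h x then insert a (orbit h x) else orbit h x)"
    proof induct
      case base
      show ?case
        using orbit.base[of h x] hN[of "h x"] \<open>a \<notin> N\<close> by (auto simp: Transposition.transpose_def)
    next
      case (step y)
      show ?case
      proof (cases "y = a")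
        case True
        then show ?thesis using step ha hN \<open>a \<notin> N\<close> by (auto split: if_splits)
      next
        case False
        then have "h y \<in> orbit h x" using step by (auto split: if_splits intro: orbit.step)
        then show ?thesis using hN[of "h y"] \<open>a \<notin> N\<close> by (auto simp: Transposition.transpose_def)
      qed
    qed
  qed
  have "a \<in> orbit ?g x" if "b \<in> orbit h x"
  proof -
    have "\<exists>y \<in> orbit h x. h y = b"
      using that permutation_self_in_orbit[OF perm, of x] by cases auto
    then obtain y where "y \<in> orbit h x" "h y = b" by blast
    then have "?g y = a" "y \<in> orbit ?g x" using sub by auto
    then show ?thesis using orbit.step by metis
  qed
  with sub sub' show ?thesis by auto
qed

text \<open>A cycle enters through its support only, so for finite \<open>N\<close> each partition
  of \<open>N\<close> is counted with the product of \<open>(card c - 1)!\<close> over its blocks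
  \<open>c\<close>. This multiplicity offsets the normalisation of the weights that describe
  derivatives.\<close>

definition cycle_sum :: "('i set \<Rightarrow> real) \<Rightarrow> 'i set \<Rightarrow> real"
  where "cycle_sum w N = (\<Sum>g | g permutes N. \<Prod>c \<in> orbit g ` N. w c)"

lemma cycle_sum_empty [simp]: "cycle_sum w {} = 1"
  by (simp add: cycle_sum_def)

text \<open>A permutation of \<open>insert a N\<close> is uniquely a permutation \<open>g\<close> of
  \<open>N\<close> followed by the transposition of \<open>a\<close> with some \<open>b\<close> in
  \<open>insert a N\<close>. The choice \<open>b = a\<close> gives a new fixed point; the
  \<open>card c\<close> choices of \<open>b\<close> in a cycle \<open>c\<close> all turn
  \<open>c\<close> into \<open>insert a c\<close>, hence the factor.\<close>

lemma cycle_sum_insert: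
  fixes w :: "'i set \<Rightarrow> real"
  assumes "finite N" "a \<notin> N"
  shows "cycle_sum w (insert a N) = w {a} * cycle_sum w N +
    (\<Sum>g | g permutes N. \<Sum>c \<in> orbit g ` N.
      card c * w (insert a c) * (\<Prod>d \<in> orbit g ` N - {c}. w d))"
proof -
  let ?t = "\<lambda>b g. \<Prod>c \<in> orbit (Transposition.transpose a b \<circ> g) ` insert a N. w c"
  have fixed: "?t a g = w {a} * (\<Prod>c \<in> orbit g ` N. w c)" if g: "g permutes N" for g
  proof -
    have "orbit g a = {a}"
      using permutes_not_in[OF g \<open>a \<notin> N\<close>] by (simp add: orbit_eq_singleton_iff)
    moreover have "{a} \<notin> orbit g ` N"
      using permutes_orbit_subset[OF g] \<open>a \<notin> N\<close> by blast
    ultimately show ?thesis using assms by simp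
  qed
  have moved: "?t b g = w (insert a (orbit g b)) * (\<Prod>d \<in> orbit g ` N - {orbit g b}. w d)"
    if g: "g permutes N" and b: "b \<in> N" for b g
  proof -
    let ?g = "Transposition.transpose a b \<circ> g"
    have "?g permutes insert a N"
      using assms b by (intro permutes_compose permutes_swap_id permutes_subset[OF g]) auto
    then have gp: "?g permutes insert a N" "finite (insert a N)" using assms by auto
    have orb: "orbit ?g x = (if orbit g x = orbit g b then insert a (orbit g b) else orbit g x)"
      if "x \<in> N" for x
      using orbit_insert_transpose[OF g \<open>finite N\<close> \<open>a \<notin> N\<close> b that]
        orbit_permutes_eq_iff[OF g \<open>finite N\<close>] by metis
    have "a \<in> orbit ?g b"
      using orb[OF b] by simp
    then have "orbit ?g a = insert a (orbit g b)"
      using orbit_permutes_eq_iff[OF gp, of b a] orb[OF b] by simp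
    then have "orbit ?g ` insert a N = insert (insert a (orbit g b)) (orbit g ` N - {orbit g b})"
      using b by (auto simp: orb image_iff split: if_splits)
    moreover have "insert a (orbit g b) \<notin> orbit g ` N"
      using permutes_orbit_subset[OF g] \<open>a \<notin> N\<close> by blast
    ultimately show ?thesis using assms by simp
  qed
  have group: "(\<Sum>b\<in>N. w (insert a (orbit g b)) * (\<Prod>d \<in> orbit g ` N - {orbit g b}. w d)) =
      (\<Sum>c \<in> orbit g ` N. card c * w (insert a c) * (\<Prod>d \<in> orbit g ` N - {c}. w d))"
    (is "(\<Sum>b\<in>N. ?k (orbit g b)) = _") if g: "g permutes N" for g
  proof -
    have perm: "permutation g"
      using assms g by (auto simp: permutation_permutes)
    \<comment> \<open>Regrouping by cycles works because the elements with orbit \<open>c\<close>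
      are exactly the elements of \<open>c\<close>.\<close>
    have fib: "{b. b \<in> N \<and> orbit g b = c} = c" if "c \<in> orbit g ` N" for c
      using that permutes_orbit_subset[OF g] orbit_permutes_eq_iff[OF g \<open>finite N\<close>]
        permutation_self_in_orbit[OF perm] by blast
    have "(\<Sum>b\<in>N. ?k (orbit g b)) = (\<Sum>c \<in> orbit g ` N. \<Sum>b | b \<in> N \<and> orbit g b = c. ?k (orbit g b))"
      using assms by (intro sum.image_gen)
    also have "\<dots> = (\<Sum>c \<in> orbit g ` N. card c * ?k c)"
    proof (intro sum.cong refl)
      fix c assume "c \<in> orbit g ` N"
      then have "(\<Sum>b | b \<in> N \<and> orbit g b = c. ?k (orbit g b)) = (\<Sum>b | b \<in> N \<and> orbit g b = c. ?k c)"
        by (intro sum.cong) auto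
      then show "(\<Sum>b | b \<in> N \<and> orbit g b = c. ?k (orbit g b)) = card c * ?k c"
        using fib[OF \<open>c \<in> orbit g ` N\<close>] by simp
    qed
    finally show ?thesis by (simp add: mult.assoc)
  qed
  have "cycle_sum w (insert a N) = (\<Sum>b\<in>insert a N. \<Sum>g | g permutes N. ?t b g)"
    unfolding cycle_sum_def by (rule sum_over_permutations_insert[OF assms])
  also have "\<dots> = (\<Sum>g | g permutes N. ?t a g) + (\<Sum>b\<in>N. \<Sum>g | g permutes N. ?t b g)"
    using assms by simp
  also have "(\<Sum>g | g permutes N. ?t a g) = w {a} * cycle_sum w N"
    unfolding cycle_sum_def sum_distrib_left by (intro sum.cong refl fixed) simp
  also have "(\<Sum>b\<in>N. \<Sum>g | g permutes N. ?t b g) =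
      (\<Sum>g | g permutes N. \<Sum>b\<in>N. w (insert a (orbit g b)) * (\<Prod>d \<in> orbit g ` N - {orbit g b}. w d))"
    by (subst sum.swap) (intro sum.cong; simp add: moved del: image_insert)
  also have "\<dots> = (\<Sum>g | g permutes N. \<Sum>c \<in> orbit g ` N.
      card c * w (insert a c) * (\<Prod>d \<in> orbit g ` N - {c}. w d))"
    by (intro sum.cong) (auto simp: group)
  finally show ?thesis .
qed

text \<open>If \<open>e = exp L\<close> and \<open>u\<close> assigns to \<open>c\<close> the mixed derivative of \<open>L\<close> in the variables of \<open>c\<close>,
  divided by \<open>(card c - 1)!\<close>, both hypotheses hold along each coordinate. So
  \<open>cycle_sum u N * e\<close> is the mixed derivative of \<open>e\<close> in the variables of \<open>N\<close>.\<close>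

lemma cycle_sum_has_derivative:
  fixes u :: "real \<Rightarrow> 'i set \<Rightarrow> real"
  assumes "finite N" "a \<notin> N"
    and u: "\<And>c. c \<subseteq> N \<Longrightarrow> c \<noteq> {} \<Longrightarrow>
      ((\<lambda>s. u s c) has_real_derivative card c * u z (insert a c)) (at z)"
    and e: "(e has_real_derivative u z {a} * e z) (at z)"
  shows "((\<lambda>s. cycle_sum (u s) N * e s) has_real_derivative
    cycle_sum (u z) (insert a N) * e z) (at z)"
proof -
  have "((\<lambda>s. cycle_sum (u s) N) has_real_derivative
      (\<Sum>g | g permutes N. \<Sum>c \<in> orbit g ` N.
        card c * u z (insert a c) * (\<Prod>d \<in> orbit g ` N - {c}. u z d))) (at z)"
    unfolding cycle_sum_def
  proof (intro DERIV_sum has_field_derivative_prod)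
    fix g c assume "g \<in> {g. g permutes N}" "c \<in> orbit g ` N"
    then show "((\<lambda>s. u s c) has_real_derivative card c * u z (insert a c)) (at z)"
      using permutes_orbit_subset[of g N] by (intro u) (auto simp: orbit_nonempty)
  qed
  \<comment> \<open>The product rule matches \<open>cycle_sum_insert\<close>: differentiating the
    weight of a cycle inserts \<open>a\<close> into it, differentiating \<open>e\<close> contributes
    \<open>a\<close> as a fixed point.\<close>
  from DERIV_mult[OF this e] show ?thesis
    by (subst cycle_sum_insert[OF assms(1,2)]) (simp add: algebra_simps)
qed

section \<open>Mixed differences and the iterated mean value theorem\<close>

text \<open>\<open>F A\<close> plays the mixed derivative of \<open>F {}\<close> in the variables of
  \<open>A\<close>, and the alternating sum is the iterated difference of \<open>F {}\<close> with
  step \<epsilon> in each variable of \<open>N\<close>. One application of the mean value theorem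
  per variable trades a difference for \<epsilon> times a derivative. Derivatives are demanded only
  on the cube, since on the Poisson side they are available only near the origin.\<close>

lemma mixed_mean_value:
  fixes F :: "'i set \<Rightarrow> ('i \<Rightarrow> real) \<Rightarrow> real"
  assumes "finite N" "\<epsilon> > 0"
    and "\<And>A a t. insert a A \<subseteq> N \<Longrightarrow> a \<notin> A \<Longrightarrow> (\<And>i. i \<in> N \<Longrightarrow> 0 \<le> t i \<and> t i \<le> \<epsilon>) \<Longrightarrow>
      (\<And>i. i \<notin> N \<Longrightarrow> t i = 0) \<Longrightarrow>
      ((\<lambda>s. F A (t(a := s))) has_real_derivative F (insert a A) t) (at (t a))"
  shows "\<exists>\<xi>. (\<forall>i. 0 \<le> \<xi> i \<and> \<xi> i \<le> \<epsilon>) \<and> (\<forall>i. i \<notin> N \<longrightarrow> \<xi> i = 0) \<and>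
    (\<Sum>S \<in> Pow N. (-1) ^ card (N - S) * F {} (\<lambda>i. if i \<in> S then \<epsilon> else 0)) = \<epsilon> ^ card N * F N \<xi>"
  using assms
proof (induction N arbitrary: F rule: finite_induct)
  case empty
  then show ?case by (intro exI[of _ "\<lambda>_. 0"]) auto
next
  case (insert a N)
  \<comment> \<open>The difference in the variable \<open>a\<close> is taken first; the resulting
    family satisfies the hypotheses for \<open>N\<close>.\<close>
  let ?F = "\<lambda>A t. F A (t(a := \<epsilon>)) - F A (t(a := 0))"
  have "((\<lambda>s. ?F A (t(b := s))) has_real_derivative ?F (insert b A) t) (at (t b))"
    if A: "insert b A \<subseteq> N" "b \<notin> A" and t: "\<And>i. i \<in> N \<Longrightarrow> 0 \<le> t i \<and> t i \<le> \<epsilon>" "\<And>i. i \<notin> N \<Longrightarrow> t i = 0"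
    for A b t
  proof -
    have ab: "a \<noteq> b" using A insert.hyps by auto
    have "((\<lambda>s. F A ((t(a := r))(b := s))) has_real_derivative F (insert b A) (t(a := r)))
        (at ((t(a := r)) b))" if "0 \<le> r" "r \<le> \<epsilon>" for r
      using that A t by (intro insert.prems(2)) auto
    from this[of \<epsilon>] this[of 0] show ?thesis
      using ab \<open>\<epsilon> > 0\<close> by (auto simp: fun_upd_twist[of a b] intro!: DERIV_diff)
  qed
  from insert.IH[OF \<open>\<epsilon> > 0\<close> this] obtain \<xi> where
    \<xi>: "\<And>i. 0 \<le> \<xi> i \<and> \<xi> i \<le> \<epsilon>" "\<And>i. i \<notin> N \<Longrightarrow> \<xi> i = 0" and
    eq: "(\<Sum>S \<in> Pow N. (-1) ^ card (N - S) * ?F {} (\<lambda>i. if i \<in> S then \<epsilon> else 0)) = \<epsilon> ^ card N * ?F N \<xi>"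
    by blast
  have "((\<lambda>s. F N (\<xi>(a := s))) has_real_derivative F (insert a N) (\<xi>(a := s))) (at s)"
    if "0 \<le> s" "s \<le> \<epsilon>" for s
  proof -
    have "0 \<le> (\<xi>(a := s)) i \<and> (\<xi>(a := s)) i \<le> \<epsilon>" for i
      using \<xi> that by simp
    then show ?thesis
      using insert.prems(2)[of a N "\<xi>(a := s)"] insert.hyps \<xi> by (simp del: fun_upd_apply add: fun_upd_same fun_upd_other)
  qed
  \<comment> \<open>The induction has used up the variables of \<open>N\<close>; the remaining
    difference in \<open>a\<close> is resolved with the other coordinates frozen at \<xi>.\<close>
  from MVT2[OF \<open>\<epsilon> > 0\<close> this] obtain z where
    z: "0 < z" "z < \<epsilon>" "?F N \<xi> = \<epsilon> * F (insert a N) (\<xi>(a := z))"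
    by auto
  \<comment> \<open>The vertices are split by whether they contain \<open>a\<close>; the two halves
    carry opposite signs and form the difference \<open>?F\<close>.\<close>
  have "(\<Sum>S \<in> Pow (insert a N). (-1) ^ card (insert a N - S) * F {} (\<lambda>i. if i \<in> S then \<epsilon> else 0)) =
     (\<Sum>S \<in> Pow N. (-1) ^ card (insert a N - S) * F {} (\<lambda>i. if i \<in> S then \<epsilon> else 0)) +
     (\<Sum>S \<in> Pow N. (-1) ^ card (insert a N - insert a S) * F {} (\<lambda>i. if i \<in> insert a S then \<epsilon> else 0))"
    using insert.hyps
    by (simp only: Pow_insert, subst sum.union_disjoint)
       (auto intro!: sum.reindex_cong[of "insert a"] inj_onI dest: insert_ident[THEN iffD1, rotated 2])
  also have "\<dots> = (\<Sum>S \<in> Pow N. (-1) ^ card (N - S) * ?F {} (\<lambda>i. if i \<in> S then \<epsilon> else 0))"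
  proof (unfold sum.distrib[symmetric], intro sum.cong refl)
    fix S assume "S \<in> Pow N"
    then have S: "finite S" "a \<notin> S" "S \<subseteq> N" using insert.hyps finite_subset by auto
    then have "insert a N - S = insert a (N - S)" "insert a N - insert a S = N - S"
      using insert.hyps by auto
    moreover have "(\<lambda>i. if i \<in> S then \<epsilon> else 0)(a := \<epsilon>) = (\<lambda>i. if i \<in> insert a S then \<epsilon> else 0)"
      "(\<lambda>i. if i \<in> S then \<epsilon> else 0)(a := 0) = (\<lambda>i. if i \<in> S then \<epsilon> else 0)"
      using S by auto
    ultimately show "(-1) ^ card (insert a N - S) * F {} (\<lambda>i. if i \<in> S then \<epsilon> else 0) +
        (-1) ^ card (insert a N - insert a S) * F {} (\<lambda>i. if i \<in> insert a S then \<epsilon> else 0) =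
        (-1) ^ card (N - S) * ?F {} (\<lambda>i. if i \<in> S then \<epsilon> else 0)"
      using insert.hyps by (simp add: algebra_simps)
  qed
  finally show ?case
    using \<xi> z insert.hyps eq
    by (intro exI[of _ "\<xi>(a := z)"] conjI) (simp_all del: fun_upd_apply add: fun_upd_def[symmetric], simp_all)
qed

text \<open>The intermediate points of the mean value theorem lie in shrinking cubes and so tend to
  the origin, where continuity of the top derivative \<open>F N\<close> gives the limit. The bound
  \<delta> keeps the cubes inside the region of differentiability.\<close>

lemma mixed_difference_tendsto:
  fixes F :: "'i set \<Rightarrow> ('i \<Rightarrow> real) \<Rightarrow> real"
  assumes "finite N" "\<delta> > 0"
    and deriv: "\<And>A a t. insert a A \<subseteq> N \<Longrightarrow> a \<notin> A \<Longrightarrow> (\<And>i. 0 \<le> t i \<and> t i \<le> \<delta>) \<Longrightarrow>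
      ((\<lambda>s. F A (t(a := s))) has_real_derivative F (insert a A) t) (at (t a))"
    and cont: "\<And>\<xi> :: nat \<Rightarrow> 'i \<Rightarrow> real. (\<And>i. (\<lambda>m. \<xi> m i) \<longlonglongrightarrow> 0) \<Longrightarrow>
      (\<lambda>m. F N (\<xi> m)) \<longlonglongrightarrow> F N (\<lambda>_. 0)"
    and \<epsilon>: "\<epsilon> \<longlonglongrightarrow> 0" "\<And>m. \<epsilon> m > 0"
  shows "(\<lambda>m. (\<Sum>S \<in> Pow N. (-1) ^ card (N - S) * F {} (\<lambda>i. if i \<in> S then \<epsilon> m else 0)) /
    \<epsilon> m ^ card N) \<longlonglongrightarrow> F N (\<lambda>_. 0)"
proof -
  let ?D = "\<lambda>e. (\<Sum>S \<in> Pow N. (-1) ^ card (N - S) * F {} (\<lambda>i. if i \<in> S then e else 0)) / e ^ card N"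
  \<comment> \<open>Points are provided for every \<open>m\<close> so that one sequence can be
    chosen; where the cube is still too large, the origin serves as a placeholder.\<close>
  have "\<exists>\<xi>. (\<forall>i. 0 \<le> \<xi> i \<and> \<xi> i \<le> \<epsilon> m) \<and> (\<epsilon> m \<le> \<delta> \<longrightarrow> ?D (\<epsilon> m) = F N \<xi>)" for m
  proof (cases "\<epsilon> m \<le> \<delta>")
    case True
    have "((\<lambda>s. F A (t(a := s))) has_real_derivative F (insert a A) t) (at (t a))"
      if "insert a A \<subseteq> N" "a \<notin> A" "\<And>i. i \<in> N \<Longrightarrow> 0 \<le> t i \<and> t i \<le> \<epsilon> m" "\<And>i. i \<notin> N \<Longrightarrow> t i = 0"
      for A a t
    proof (rule deriv[OF that(1,2)])
      show "0 \<le> t i \<and> t i \<le> \<delta>" for i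
        using that(3,4)[of i] True \<open>\<delta> > 0\<close> by (cases "i \<in> N") auto
    qed
    from mixed_mean_value[where F = F, OF \<open>finite N\<close> \<epsilon>(2) this] obtain \<xi> where
      "\<forall>i. 0 \<le> \<xi> i \<and> \<xi> i \<le> \<epsilon> m" and
      "(\<Sum>S \<in> Pow N. (-1) ^ card (N - S) * F {} (\<lambda>i. if i \<in> S then \<epsilon> m else 0)) = \<epsilon> m ^ card N * F N \<xi>"
      by blast
    then show ?thesis
      using \<epsilon>(2)[of m] by (intro exI[of _ \<xi>]) simp
  next
    case False
    then show ?thesis
      using \<epsilon>(2)[of m] by (intro exI[of _ "\<lambda>_. 0"]) auto
  qed
  then have "\<exists>\<xi>. \<forall>m. (\<forall>i. 0 \<le> \<xi> m i \<and> \<xi> m i \<le> \<epsilon> m) \<and> (\<epsilon> m \<le> \<delta> \<longrightarrow> ?D (\<epsilon> m) = F N (\<xi> m))"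
    by (intro choice allI)
  then obtain \<xi> where \<xi>: "\<And>m i. 0 \<le> \<xi> m i \<and> \<xi> m i \<le> \<epsilon> m"
    and eq: "\<And>m. \<epsilon> m \<le> \<delta> \<Longrightarrow> ?D (\<epsilon> m) = F N (\<xi> m)"
    by blast
  have "(\<lambda>m. \<xi> m i) \<longlonglongrightarrow> 0" for i
    by (rule tendsto_sandwich[OF always_eventually always_eventually tendsto_const \<epsilon>(1)])
       (simp_all add: \<xi>)
  then have "(\<lambda>m. F N (\<xi> m)) \<longlonglongrightarrow> F N (\<lambda>_. 0)"
    by (rule cont)
  moreover have "eventually (\<lambda>m. \<epsilon> m < \<delta>) sequentially"
    using order_tendstoD(2)[OF \<epsilon>(1) \<open>\<delta> > 0\<close>] .
  then have "eventually (\<lambda>m. ?D (\<epsilon> m) = F N (\<xi> m)) sequentially"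
    by eventually_elim (simp add: eq)
  ultimately show ?thesis
    by (simp add: tendsto_cong)
qed

section \<open>Continuity and size of cycle sums\<close>

lemma tendsto_cycle_sum [tendsto_intros]:
  fixes u :: "'b \<Rightarrow> 'i set \<Rightarrow> real"
  assumes "\<And>c. c \<subseteq> N \<Longrightarrow> c \<noteq> {} \<Longrightarrow> ((\<lambda>x. u x c) \<longlongrightarrow> v c) G"
  shows "((\<lambda>x. cycle_sum (u x) N) \<longlongrightarrow> cycle_sum v N) G"
  unfolding cycle_sum_def
proof (intro tendsto_sum tendsto_prod)
  fix g c assume "g \<in> {g. g permutes N}" "c \<in> orbit g ` N"
  then show "((\<lambda>x. u x c) \<longlongrightarrow> v c) G"
    using permutes_orbit_subset[of g N] by (intro assms) (auto simp: orbit_nonempty)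
qed

text \<open>Each permutation has at most \<open>card N\<close> cycles, and \<open>1 \<le> Y\<close>
  lets the number of factors be raised to \<open>card N\<close>.\<close>

lemma abs_cycle_sum_le:
  fixes w :: "'i set \<Rightarrow> real" and Y :: real
  assumes "finite N" "1 \<le> Y" and "\<And>c. c \<subseteq> N \<Longrightarrow> c \<noteq> {} \<Longrightarrow> \<bar>w c\<bar> \<le> Y"
  shows "\<bar>cycle_sum w N\<bar> \<le> fact (card N) * Y ^ card N"
proof -
  have "\<bar>\<Prod>c \<in> orbit g ` N. w c\<bar> \<le> Y ^ card N" if g: "g permutes N" for g
  proof -
    have "\<bar>\<Prod>c \<in> orbit g ` N. w c\<bar> \<le> (\<Prod>c \<in> orbit g ` N. Y)"
      unfolding abs_prod using permutes_orbit_subset[OF g]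
      by (intro prod_mono) (auto intro!: assms(3) simp: orbit_nonempty)
    also have "\<dots> \<le> Y ^ card N"
      using assms by (auto intro!: power_increasing card_image_le)
    finally show ?thesis .
  qed
  then have "\<bar>cycle_sum w N\<bar> \<le> (\<Sum>g | g permutes N. Y ^ card N)"
    unfolding cycle_sum_def by (intro order_trans[OF sum_abs] sum_mono) auto
  then show ?thesis
    using assms by (simp add: card_permutations)
qed

section \<open>The exponential generating functions\<close>

text \<open>The weight that \<open>cycle_sum_has_derivative\<close> attaches to the logarithm of \<open>wick_exp\<close> below at the point \<open>t\<close>;
  the logarithm is quadratic, so cycles of length at least three have weight zero.\<close>

definition hermite_weight ::
  "nat set \<Rightarrow> (nat \<Rightarrow> real) \<Rightarrow> (nat \<Rightarrow> nat \<Rightarrow> real) \<Rightarrow> (nat \<Rightarrow> real) \<Rightarrow> nat set \<Rightarrow> real"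
  where "hermite_weight N X b t c =
    (if card c = 1 then X (Min c) - (\<Sum>j\<in>N. b (Min c) j * t j)
     else if card c = 2 then - b (Min c) (Max c) else 0)"

text \<open>If \<open>X i\<close> is the noise tested on \<open>f i\<close> and \<open>b\<close> is
  the Gram matrix of the \<open>f i\<close>, this is the normalised exponential of white noise at
  \<open>\<Sum>i\<in>N. t i * f i x\<close>, as a function of \<open>x\<close>.\<close>

definition wick_exp :: "'i set \<Rightarrow> ('i \<Rightarrow> real) \<Rightarrow> ('i \<Rightarrow> 'i \<Rightarrow> real) \<Rightarrow> ('i \<Rightarrow> real) \<Rightarrow> real"
  where "wick_exp N X b t =
    exp ((\<Sum>i\<in>N. t i * X i) - (\<Sum>i\<in>N. \<Sum>j\<in>N. b i j * t i * t j) / 2)"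

lemma sum_fun_upd:
  fixes c :: "'i \<Rightarrow> real"
  assumes "finite N" "a \<in> N"
  shows "(\<Sum>j\<in>N. c j * (t(a := s)) j) = c a * s + (\<Sum>j\<in>N - {a}. c j * t j)"
  using assms by (subst sum.remove[of N a]) auto

lemma linear_has_derivative:
  fixes c :: "'i \<Rightarrow> real"
  assumes "finite N" "a \<in> N"
  shows "((\<lambda>s. \<Sum>j\<in>N. c j * (t(a := s)) j) has_real_derivative c a) (at z)"
  unfolding sum_fun_upd[OF assms] by (auto intro!: derivative_eq_intros)

text \<open>The weight of a fixed point \<open>i\<close> is affine in \<open>t\<close> with slope
  \<open>- b i a\<close> along \<open>a\<close>, which is the weight of the pair
  \<open>{i, a}\<close>; all other weights are constant, and those of larger sets vanish. Symmetry
  of \<open>b\<close> makes the ordering by \<open>Min\<close> and \<open>Max\<close>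
  immaterial.\<close>

lemma hermite_weight_has_derivative:
  fixes X :: "nat \<Rightarrow> real" and b :: "nat \<Rightarrow> nat \<Rightarrow> real" and t :: "nat \<Rightarrow> real"
  assumes "finite N" "a \<in> N" "a \<notin> c" "c \<noteq> {}" "c \<subseteq> N"
    and sym: "\<And>i j. b i j = b j i"
  shows "((\<lambda>s. hermite_weight N X b (t(a := s)) c) has_real_derivative
    card c * hermite_weight N X b t (insert a c)) (at (t a))"
proof -
  have fin: "finite c" using assms finite_subset by blast
  consider i where "c = {i}" | "card c \<ge> 2"
  proof (cases "card c = 1")
    case True
    then show ?thesis using that(1) by (rule card_1_singletonE)
  next
    case False
    moreover have "card c > 0" using fin \<open>c \<noteq> {}\<close> by (simp add: card_gt_0_iff)
    ultimately show ?thesis using that(2) by linarith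
  qed
  then show ?thesis
  proof cases
    case (1 i)
    have "b (min a i) (max a i) = b i a"
      using sym by (cases "a \<le> i") (auto simp: min_def max_def)
    moreover have "a \<noteq> i" using 1 assms by auto
    moreover have "((\<lambda>s. X i - (\<Sum>j\<in>N. b i j * (t(a := s)) j)) has_real_derivative 0 - b i a) (at (t a))"
      by (intro DERIV_diff DERIV_const linear_has_derivative assms)
    ultimately show ?thesis
      using 1 by (simp add: hermite_weight_def del: fun_upd_apply)
  next
    case 2
    then show ?thesis
      using fin \<open>a \<notin> c\<close> by (auto simp: hermite_weight_def)
  qed
qed

text \<open>By symmetry the quadratic form contributes row \<open>a\<close> of \<open>b\<close>
  twice, which cancels the factor 1/2. The logarithmic derivative is then the weight of the fixed
  point \<open>a\<close>.\<close>

lemma wick_exp_has_derivative: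
  fixes X :: "'i \<Rightarrow> real" and b :: "'i \<Rightarrow> 'i \<Rightarrow> real" and t :: "'i \<Rightarrow> real"
  assumes "finite N" "a \<in> N" and sym: "\<And>i j. b i j = b j i"
  shows "((\<lambda>s. wick_exp N X b (t(a := s))) has_real_derivative
    (X a - (\<Sum>j\<in>N. b a j * t j)) * wick_exp N X b t) (at (t a))"
proof -
  let ?t = "\<lambda>s. t(a := s)"
  have comp: "((\<lambda>s. ?t s i) has_real_derivative (if i = a then 1 else 0)) (at z)" for i z
    by (auto intro!: derivative_eq_intros)
  have 1: "((\<lambda>s. \<Sum>i\<in>N. ?t s i * X i) has_real_derivative X a) (at (t a))"
    using linear_has_derivative[OF assms(1,2), of X t "t a"] by (simp add: mult.commute)
  have "((\<lambda>s. \<Sum>i\<in>N. \<Sum>j\<in>N. b i j * ?t s i * ?t s j) has_real_derivative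
     (\<Sum>i\<in>N. \<Sum>j\<in>N. b i j * (if i = a then 1 else 0) * t j + b i j * t i * (if j = a then 1 else 0))) (at (t a))"
  proof (intro DERIV_sum)
    fix i j
    show "((\<lambda>s. b i j * ?t s i * ?t s j) has_real_derivative
        b i j * (if i = a then 1 else 0) * t j + b i j * t i * (if j = a then 1 else 0)) (at (t a))"
      by (rule DERIV_cong[OF DERIV_mult[OF DERIV_cmult[OF comp] comp]]) simp
  qed
  also have "(\<Sum>i\<in>N. \<Sum>j\<in>N. b i j * (if i = a then 1 else 0) * t j + b i j * t i * (if j = a then 1 else 0)) =
      (\<Sum>i\<in>N. if i = a then (\<Sum>j\<in>N. b i j * t j) else 0) + (\<Sum>i\<in>N. b i a * t i)"
  proof -
    have "(\<Sum>j\<in>N. b i j * (if i = a then 1 else 0) * t j) =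
        (if i = a then (\<Sum>j\<in>N. b i j * t j) else 0)" for i
      by simp
    moreover have "(\<Sum>j\<in>N. b i j * t i * (if j = a then 1 else 0)) =
        (\<Sum>j\<in>N. if j = a then b i j * t i else 0)" for i
      by (intro sum.cong) auto
    ultimately show ?thesis
      using assms(1,2) by (simp only: sum.distrib sum.delta if_True)
  qed
  also have "\<dots> = 2 * (\<Sum>j\<in>N. b a j * t j)"
    using assms(1,2) by (simp add: sym[of _ a])
  finally have 2: "((\<lambda>s. \<Sum>i\<in>N. \<Sum>j\<in>N. b i j * ?t s i * ?t s j) has_real_derivative
     2 * (\<Sum>j\<in>N. b a j * t j)) (at (t a))" .
  have "((\<lambda>s. wick_exp N X b (?t s)) has_real_derivative
     exp ((\<Sum>i\<in>N. ?t (t a) i * X i) - (\<Sum>i\<in>N. \<Sum>j\<in>N. b i j * ?t (t a) i * ?t (t a) j) / 2) *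
      (X a - 2 * (\<Sum>j\<in>N. b a j * t j) / 2)) (at (t a))"
    unfolding wick_exp_def
    by (intro DERIV_fun_exp DERIV_diff DERIV_cdivide 1 2)
  then show ?thesis
    unfolding wick_exp_def by (simp add: mult.commute)
qed

text \<open>These products form the family to which the iterated mean value theorem is applied: for
  \<open>A = {}\<close> they reduce to \<open>wick_exp\<close>, and for \<open>A = N\<close> at the
  origin to the Hermite sum.\<close>

lemma wick_cycle_sum_has_derivative:
  fixes X :: "nat \<Rightarrow> real" and b :: "nat \<Rightarrow> nat \<Rightarrow> real" and t :: "nat \<Rightarrow> real"
  assumes "finite N" "insert a A \<subseteq> N" "a \<notin> A" and sym: "\<And>i j. b i j = b j i"
  shows "((\<lambda>s. cycle_sum (hermite_weight N X b (t(a := s))) A * wick_exp N X b (t(a := s)))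
    has_real_derivative cycle_sum (hermite_weight N X b t) (insert a A) * wick_exp N X b t) (at (t a))"
proof -
  let ?u = "\<lambda>s. hermite_weight N X b (t(a := s))"
  have A: "finite A" using assms finite_subset by auto
  have "((\<lambda>s. cycle_sum (?u s) A * wick_exp N X b (t(a := s)))
    has_real_derivative cycle_sum (?u (t a)) (insert a A) * wick_exp N X b (t(a := t a))) (at (t a))"
  proof (rule cycle_sum_has_derivative[OF A \<open>a \<notin> A\<close>])
    show "((\<lambda>s. ?u s c) has_real_derivative card c * ?u (t a) (insert a c)) (at (t a))"
      if "c \<subseteq> A" "c \<noteq> {}" for c
      using hermite_weight_has_derivative[of N a c b X t] that assms by auto
    show "((\<lambda>s. wick_exp N X b (t(a := s))) has_real_derivative
        ?u (t a) {a} * wick_exp N X b (t(a := t a))) (at (t a))"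
      using wick_exp_has_derivative[of N a b X t] assms by (simp add: hermite_weight_def)
  qed
  then show ?thesis by simp
qed

lemma wick_cycle_sum_tendsto:
  fixes X :: "nat \<Rightarrow> real" and b :: "nat \<Rightarrow> nat \<Rightarrow> real" and \<xi> :: "nat \<Rightarrow> nat \<Rightarrow> real"
  assumes "\<And>i. (\<lambda>m::nat. \<xi> m i) \<longlonglongrightarrow> 0"
  shows "(\<lambda>m. cycle_sum (hermite_weight N X b (\<xi> m)) N * wick_exp N X b (\<xi> m)) \<longlonglongrightarrow>
    cycle_sum (hermite_weight N X b (\<lambda>_. 0)) N * wick_exp N X b (\<lambda>_. 0)"
proof -
  have "(\<lambda>m. \<Sum>j\<in>N. b i j * \<xi> m j) \<longlonglongrightarrow> 0" for i
    by (intro tendsto_null_sum tendsto_mult_right_zero assms)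
  then have "(\<lambda>m. hermite_weight N X b (\<xi> m) c) \<longlonglongrightarrow> hermite_weight N X b (\<lambda>_. 0) c" for c
    using tendsto_diff[OF tendsto_const] by (fastforce simp: hermite_weight_def)
  then show ?thesis
    unfolding wick_exp_def by (intro tendsto_intros assms) simp_all
qed

text \<open>The bound is uniform over the unit cube and depends on \<open>X\<close> only through an
  exponential of absolute values, so exponential moments of white noise make it square integrable.
  The factor \<open>card N + 1\<close> accounts for up to \<open>card N\<close> cycle weights and
  for \<open>wick_exp\<close>.\<close>

lemma abs_wick_cycle_sum_le:
  fixes X :: "nat \<Rightarrow> real" and b :: "nat \<Rightarrow> nat \<Rightarrow> real" and t :: "nat \<Rightarrow> real" and B :: real
  assumes "finite N" and t: "\<And>i. 0 \<le> t i \<and> t i \<le> 1"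
  defines "B \<equiv> 1 + (\<Sum>i\<in>N. \<Sum>j\<in>N. \<bar>b i j\<bar>)"
  shows "\<bar>cycle_sum (hermite_weight N X b t) N * wick_exp N X b t\<bar> \<le>
    fact (card N) * exp ((card N + 1) * B) * exp ((card N + 1) * (\<Sum>i\<in>N. \<bar>X i\<bar>))"
proof -
  let ?n = "card N"
  \<comment> \<open>\<open>?Y\<close> bounds every single weight as well as the exponent of
    \<open>wick_exp\<close>; the summand 1 in \<open>B\<close> ensures that it is at least
    1.\<close>
  let ?Y = "B + (\<Sum>i\<in>N. \<bar>X i\<bar>)"
  have bij: "\<bar>b i j\<bar> \<le> B - 1" if "i \<in> N" "j \<in> N" for i j
  proof -
    have "\<bar>b i j\<bar> \<le> (\<Sum>j\<in>N. \<bar>b i j\<bar>)"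
      using that assms by (intro member_le_sum) auto
    also have "\<dots> \<le> B - 1"
      unfolding B_def using that assms by (auto intro!: member_le_sum sum_nonneg)
    finally show ?thesis .
  qed
  have row: "\<bar>\<Sum>j\<in>N. b i j * t j\<bar> \<le> B - 1" if "i \<in> N" for i
  proof -
    have "\<bar>\<Sum>j\<in>N. b i j * t j\<bar> \<le> (\<Sum>j\<in>N. \<bar>b i j\<bar>)"
      using t by (intro order_trans[OF sum_abs] sum_mono) (simp add: abs_mult mult_left_le)
    also have "\<dots> \<le> B - 1"
      unfolding B_def using that assms by (auto intro!: member_le_sum sum_nonneg)
    finally show ?thesis .
  qed
  have X: "\<bar>X i\<bar> \<le> (\<Sum>i\<in>N. \<bar>X i\<bar>)" if "i \<in> N" for i
    using that assms by (intro member_le_sum) auto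
  have "0 \<le> (\<Sum>i\<in>N. \<bar>X i\<bar>)" "1 \<le> B" unfolding B_def by (auto intro!: sum_nonneg)
  then have Y: "1 \<le> ?Y" by linarith
  have "\<bar>hermite_weight N X b t c\<bar> \<le> ?Y" if c: "c \<subseteq> N" "c \<noteq> {}" for c
  proof -
    have "finite c" using c assms finite_subset by auto
    then have "Min c \<in> N" "Max c \<in> N" using c Min_in Max_in by blast+
    then show ?thesis
      using row[of "Min c"] X[of "Min c"] bij[of "Min c" "Max c"] Y \<open>0 \<le> (\<Sum>i\<in>N. \<bar>X i\<bar>)\<close>
      by (auto simp: hermite_weight_def)
  qed
  then have "\<bar>cycle_sum (hermite_weight N X b t) N\<bar> \<le> fact ?n * ?Y ^ ?n"
    by (intro abs_cycle_sum_le assms Y)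
  also have "\<dots> \<le> fact ?n * exp ?Y ^ ?n"
    using Y exp_ge_add_one_self[of ?Y] by (intro mult_left_mono power_mono fact_ge_zero) linarith+
  finally have 1: "\<bar>cycle_sum (hermite_weight N X b t) N\<bar> \<le> fact ?n * exp (?n * ?Y)"
    by (simp add: exp_of_nat_mult)
  have "\<bar>\<Sum>i\<in>N. t i * X i\<bar> \<le> (\<Sum>i\<in>N. \<bar>X i\<bar>)"
    using t by (intro order_trans[OF sum_abs] sum_mono) (simp add: abs_mult mult_left_le_one_le)
  moreover have "\<bar>\<Sum>i\<in>N. \<Sum>j\<in>N. b i j * t i * t j\<bar> \<le> B - 1"
  proof -
    have "\<bar>b i j * t i * t j\<bar> \<le> \<bar>b i j\<bar>" for i j
      using t[of i] t[of j] by (simp add: abs_mult mult.assoc mult_left_le mult_le_one)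
    then have "\<bar>\<Sum>i\<in>N. \<Sum>j\<in>N. b i j * t i * t j\<bar> \<le> (\<Sum>i\<in>N. \<Sum>j\<in>N. \<bar>b i j\<bar>)"
      by (intro order_trans[OF sum_abs] sum_mono) auto
    then show ?thesis by (simp add: B_def)
  qed
  ultimately have "wick_exp N X b t \<le> exp ?Y"
    unfolding wick_exp_def using \<open>1 \<le> B\<close> by simp
  then have "\<bar>cycle_sum (hermite_weight N X b t) N * wick_exp N X b t\<bar> \<le> (fact ?n * exp (?n * ?Y)) * exp ?Y"
    unfolding abs_mult by (intro mult_mono 1) (auto simp: wick_exp_def)
  also have "\<dots> = fact ?n * exp ((?n + 1) * B) * exp ((?n + 1) * (\<Sum>i\<in>N. \<bar>X i\<bar>))"
    by (simp add: exp_add[symmetric] algebra_simps)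
  finally show ?thesis .
qed

text \<open>The analogous weight for the logarithm of \<open>poisson_exp\<close> below. It is meaningful only where no
  factor of \<open>poisson_exp\<close> vanishes, which for a fixed configuration holds near \<open>t = 0\<close>.\<close>

definition charlier_weight ::
  "'i set \<Rightarrow> 'a set \<Rightarrow> ('i \<Rightarrow> 'a \<Rightarrow> real) \<Rightarrow> ('i \<Rightarrow> real) \<Rightarrow> ('i \<Rightarrow> real) \<Rightarrow> 'i set \<Rightarrow> real"
  where "charlier_weight N \<omega> f m t c =
    (-1) ^ (card c - 1) * (\<Sum>x\<in>\<omega>. \<Prod>i\<in>c. f i x / (1 + (\<Sum>j\<in>N. f j x * t j))) -
    (if card c = 1 then m (the_elem c) else 0)"

text \<open>With \<open>m j\<close> the integral of \<open>f j\<close>, this is the value prescribed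
  for the image of the normalised exponential at the linear combination of the \<open>f j\<close>
  with coefficients \<open>t\<close>.\<close>

definition poisson_exp ::
  "'i set \<Rightarrow> 'a set \<Rightarrow> ('i \<Rightarrow> 'a \<Rightarrow> real) \<Rightarrow> ('i \<Rightarrow> real) \<Rightarrow> ('i \<Rightarrow> real) \<Rightarrow> real"
  where "poisson_exp N \<omega> f m t =
    (\<Prod>x\<in>\<omega>. 1 + (\<Sum>j\<in>N. f j x * t j)) * exp (- (\<Sum>j\<in>N. m j * t j))"

text \<open>Let \<open>h x\<close> be the linear combination of the \<open>f j x\<close>. In the
  weight of a set of size \<open>Suc k\<close>, \<open>t\<close> enters through the power
  \<open>- Suc k\<close> of \<open>1 + h x\<close>. Differentiating along \<open>a\<close> brings
  down \<open>- Suc k * f a x\<close> and lowers the exponent by one: this is the change of sign,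
  the factor \<open>card c\<close> and the new quotient for \<open>a\<close>. The integral term is
  constant and occurs for singletons only.\<close>

lemma charlier_weight_has_derivative:
  fixes f :: "'i \<Rightarrow> 'a \<Rightarrow> real" and m :: "'i \<Rightarrow> real" and t :: "'i \<Rightarrow> real"
  assumes "finite N" "a \<in> N" "a \<notin> c" "c \<noteq> {}" "c \<subseteq> N"
    and nz: "\<And>x. x \<in> \<omega> \<Longrightarrow> 1 + (\<Sum>j\<in>N. f j x * t j) \<noteq> 0"
  shows "((\<lambda>s. charlier_weight N \<omega> f m (t(a := s)) c) has_real_derivative
    card c * charlier_weight N \<omega> f m t (insert a c)) (at (t a))"
proof -
  have fin: "finite c" using assms finite_subset by blast
  then obtain k where k: "card c = Suc k" using \<open>c \<noteq> {}\<close> by (metis card_gt_0_iff Suc_pred)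
  let ?L = "\<lambda>t x. 1 + (\<Sum>j\<in>N. f j x * t j)"
  let ?p = "\<lambda>x. \<Prod>i\<in>c. f i x"
  have L: "((\<lambda>s. ?L (t(a := s)) x) has_real_derivative f a x) (at (t a))" for x
    using DERIV_add[OF DERIV_const linear_has_derivative[OF assms(1,2), of "\<lambda>j. f j x" t "t a"]] by simp
  have "((\<lambda>s. (-1) ^ k * (\<Sum>x\<in>\<omega>. ?p x * inverse (?L (t(a := s)) x) ^ Suc k)) has_real_derivative
     (-1) ^ k * (\<Sum>x\<in>\<omega>. - Suc k * (?p x * f a x * inverse (?L t x) ^ Suc (Suc k)))) (at (t a))"
  proof (intro DERIV_cmult DERIV_sum)
    fix x assume x: "x \<in> \<omega>"
    have "?L (t(a := t a)) x \<noteq> 0" using nz[OF x] by simp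
    from DERIV_inverse_fun[OF L this]
    have "((\<lambda>s. inverse (?L (t(a := s)) x)) has_real_derivative - (f a x * inverse (?L t x) ^ 2)) (at (t a))"
      by (simp add: power2_eq_square mult.assoc)
    from DERIV_cmult[OF DERIV_power[OF this, of "Suc k"], of "?p x"]
    show "((\<lambda>s. ?p x * inverse (?L (t(a := s)) x) ^ Suc k) has_real_derivative
       - Suc k * (?p x * f a x * inverse (?L t x) ^ Suc (Suc k))) (at (t a))"
      by (rule DERIV_cong) (simp add: algebra_simps power2_eq_square)
  qed
  then have "((\<lambda>s. (-1) ^ k * (\<Sum>x\<in>\<omega>. ?p x * inverse (?L (t(a := s)) x) ^ Suc k) -
      (if card c = 1 then m (the_elem c) else 0)) has_real_derivative
     (-1) ^ k * (\<Sum>x\<in>\<omega>. - Suc k * (?p x * f a x * inverse (?L t x) ^ Suc (Suc k))) - 0) (at (t a))"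
    by (intro DERIV_diff DERIV_const)
  moreover have "charlier_weight N \<omega> f m r c = (-1) ^ k * (\<Sum>x\<in>\<omega>. ?p x * inverse (?L r x) ^ Suc k) -
      (if card c = 1 then m (the_elem c) else 0)" for r
    using k by (simp add: charlier_weight_def divide_inverse prod.distrib)
  moreover have "card c * charlier_weight N \<omega> f m t (insert a c) =
      (-1) ^ k * (\<Sum>x\<in>\<omega>. - Suc k * (?p x * f a x * inverse (?L t x) ^ Suc (Suc k)))"
    using k fin \<open>a \<notin> c\<close>
    by (simp add: charlier_weight_def divide_inverse prod.distrib sum_distrib_left algebra_simps)
  ultimately show ?thesis by simp
qed

text \<open>Logarithmic differentiation, for which the factors must not vanish: each contributes
  \<open>f a x\<close> divided by itself, the exponential contributes \<open>- m a\<close>, and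
  together they form the weight of \<open>{a}\<close>.\<close>

lemma poisson_exp_has_derivative:
  fixes f :: "'i \<Rightarrow> 'a \<Rightarrow> real" and m :: "'i \<Rightarrow> real" and t :: "'i \<Rightarrow> real"
  assumes "finite N" "a \<in> N"
    and nz: "\<And>x. x \<in> \<omega> \<Longrightarrow> 1 + (\<Sum>j\<in>N. f j x * t j) \<noteq> 0"
  shows "((\<lambda>s. poisson_exp N \<omega> f m (t(a := s))) has_real_derivative
    charlier_weight N \<omega> f m t {a} * poisson_exp N \<omega> f m t) (at (t a))"
proof -
  let ?L = "\<lambda>t x. 1 + (\<Sum>j\<in>N. f j x * t j)"
  have L: "((\<lambda>s. ?L (t(a := s)) x) has_real_derivative f a x) (at (t a))" for x
    using DERIV_add[OF DERIV_const linear_has_derivative[OF assms(1,2), of "\<lambda>j. f j x" t "t a"]] by simp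
  have 1: "((\<lambda>s. \<Prod>x\<in>\<omega>. ?L (t(a := s)) x) has_real_derivative
      (\<Prod>x\<in>\<omega>. ?L (t(a := t a)) x) * (\<Sum>x\<in>\<omega>. f a x / ?L (t(a := t a)) x)) (at (t a))"
    using nz by (intro has_field_derivative_prod' L) simp
  have 2: "((\<lambda>s. exp (- (\<Sum>j\<in>N. m j * (t(a := s)) j))) has_real_derivative
      exp (- (\<Sum>j\<in>N. m j * (t(a := t a)) j)) * (- m a)) (at (t a))"
    by (intro DERIV_fun_exp DERIV_minus linear_has_derivative assms)
  from DERIV_mult[OF 1 2] show ?thesis
    unfolding poisson_exp_def
    by (rule DERIV_cong) (simp add: charlier_weight_def algebra_simps)
qed

lemma poisson_cycle_sum_has_derivative:
  fixes f :: "'i \<Rightarrow> 'a \<Rightarrow> real" and m :: "'i \<Rightarrow> real" and t :: "'i \<Rightarrow> real"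
  assumes "finite N" "insert a A \<subseteq> N" "a \<notin> A"
    and nz: "\<And>x. x \<in> \<omega> \<Longrightarrow> 1 + (\<Sum>j\<in>N. f j x * t j) \<noteq> 0"
  shows "((\<lambda>s. cycle_sum (charlier_weight N \<omega> f m (t(a := s))) A * poisson_exp N \<omega> f m (t(a := s)))
    has_real_derivative cycle_sum (charlier_weight N \<omega> f m t) (insert a A) * poisson_exp N \<omega> f m t) (at (t a))"
proof -
  let ?u = "\<lambda>s. charlier_weight N \<omega> f m (t(a := s))"
  have A: "finite A" using assms finite_subset by auto
  have "((\<lambda>s. cycle_sum (?u s) A * poisson_exp N \<omega> f m (t(a := s))) has_real_derivative
     cycle_sum (?u (t a)) (insert a A) * poisson_exp N \<omega> f m (t(a := t a))) (at (t a))"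
  proof (rule cycle_sum_has_derivative[OF A \<open>a \<notin> A\<close>])
    show "((\<lambda>s. ?u s c) has_real_derivative card c * ?u (t a) (insert a c)) (at (t a))"
      if "c \<subseteq> A" "c \<noteq> {}" for c
      using charlier_weight_has_derivative[of N a c \<omega> f t m] that assms by auto
    show "((\<lambda>s. poisson_exp N \<omega> f m (t(a := s))) has_real_derivative
        ?u (t a) {a} * poisson_exp N \<omega> f m (t(a := t a))) (at (t a))"
      using poisson_exp_has_derivative[of N a \<omega> f t m] assms by simp
  qed
  then show ?thesis by simp
qed

lemma poisson_cycle_sum_tendsto:
  fixes f :: "'i \<Rightarrow> 'a \<Rightarrow> real" and m :: "'i \<Rightarrow> real" and \<xi> :: "nat \<Rightarrow> 'i \<Rightarrow> real"
  assumes "\<And>i. (\<lambda>k::nat. \<xi> k i) \<longlonglongrightarrow> 0"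
  shows "(\<lambda>k. cycle_sum (charlier_weight N \<omega> f m (\<xi> k)) N * poisson_exp N \<omega> f m (\<xi> k)) \<longlonglongrightarrow>
    cycle_sum (charlier_weight N \<omega> f m (\<lambda>_. 0)) N * poisson_exp N \<omega> f m (\<lambda>_. 0)"
proof -
  have L: "(\<lambda>k. 1 + (\<Sum>j\<in>N. f j x * \<xi> k j)) \<longlonglongrightarrow> 1 + (\<Sum>j\<in>N. f j x * 0)" for x
    by (intro tendsto_intros assms)
  show ?thesis
    unfolding charlier_weight_def poisson_exp_def
    by (intro tendsto_intros assms L) simp
qed

section \<open>Convergence and bounds of the mixed difference quotients\<close>

lemma poisson_mixed_difference_tendsto:
  fixes f :: "'i \<Rightarrow> 'a \<Rightarrow> real" and m :: "'i \<Rightarrow> real" and \<epsilon> :: "nat \<Rightarrow> real"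
  assumes "finite N" "finite \<omega>" and \<epsilon>: "\<epsilon> \<longlonglongrightarrow> 0" "\<And>k. \<epsilon> k > 0"
  shows "(\<lambda>k. (\<Sum>S \<in> Pow N. (-1) ^ card (N - S) *
      poisson_exp N \<omega> f m (\<lambda>i. if i \<in> S then \<epsilon> k else 0)) / \<epsilon> k ^ card N)
    \<longlonglongrightarrow> cycle_sum (charlier_weight N \<omega> f m (\<lambda>_. 0)) N"
proof -
  let ?F = "\<lambda>A t. cycle_sum (charlier_weight N \<omega> f m t) A * poisson_exp N \<omega> f m t"
  \<comment> \<open>For coordinates in \<open>[0, 1 / K]\<close> the linear combination is below 1
    in absolute value at each point of the configuration, so no factor vanishes. \<open>K\<close>
    depends on the configuration, and the convergence is accordingly pointwise.\<close>
  define K where "K = 1 + (\<Sum>x\<in>\<omega>. \<Sum>j\<in>N. \<bar>f j x\<bar>)"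
  have "K \<ge> 1" unfolding K_def by (auto intro!: sum_nonneg)
  have nz: "1 + (\<Sum>j\<in>N. f j x * t j) \<noteq> 0" if "x \<in> \<omega>" and t: "\<And>i. 0 \<le> t i \<and> t i \<le> 1 / K" for x t
  proof -
    have "\<bar>\<Sum>j\<in>N. f j x * t j\<bar> \<le> (\<Sum>j\<in>N. \<bar>f j x\<bar> * (1 / K))"
      using t by (intro order_trans[OF sum_abs] sum_mono) (simp add: abs_mult mult_left_mono del: times_divide_eq_right)
    also have "\<dots> = (\<Sum>j\<in>N. \<bar>f j x\<bar>) / K"
      by (simp add: sum_divide_distrib)
    also have "(\<Sum>j\<in>N. \<bar>f j x\<bar>) \<le> (\<Sum>x\<in>\<omega>. \<Sum>j\<in>N. \<bar>f j x\<bar>)"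
      using that assms by (intro member_le_sum) (auto intro!: sum_nonneg)
    then have "(\<Sum>j\<in>N. \<bar>f j x\<bar>) / K < 1"
      using \<open>K \<ge> 1\<close> by (simp add: K_def)
    finally show ?thesis by linarith
  qed
  have "(\<lambda>k. (\<Sum>S \<in> Pow N. (-1) ^ card (N - S) * ?F {} (\<lambda>i. if i \<in> S then \<epsilon> k else 0)) / \<epsilon> k ^ card N)
      \<longlonglongrightarrow> ?F N (\<lambda>_. 0)"
  proof (rule mixed_difference_tendsto[where \<delta> = "1 / K"])
    show "1 / K > 0" using \<open>K \<ge> 1\<close> by simp
  qed (use assms nz in \<open>auto intro!: poisson_cycle_sum_has_derivative poisson_cycle_sum_tendsto simp del: fun_upd_apply\<close>)
  then show ?thesis by (simp add: poisson_exp_def)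
qed

lemma wick_mixed_difference_tendsto:
  fixes X :: "nat \<Rightarrow> real" and b :: "nat \<Rightarrow> nat \<Rightarrow> real" and \<epsilon> :: "nat \<Rightarrow> real"
  assumes "finite N" and sym: "\<And>i j. b i j = b j i" and \<epsilon>: "\<epsilon> \<longlonglongrightarrow> 0" "\<And>k. \<epsilon> k > 0"
  shows "(\<lambda>k. (\<Sum>S \<in> Pow N. (-1) ^ card (N - S) *
      wick_exp N X b (\<lambda>i. if i \<in> S then \<epsilon> k else 0)) / \<epsilon> k ^ card N)
    \<longlonglongrightarrow> cycle_sum (hermite_weight N X b (\<lambda>_. 0)) N"
proof -
  let ?F = "\<lambda>A t. cycle_sum (hermite_weight N X b t) A * wick_exp N X b t"
  have "(\<lambda>k. (\<Sum>S \<in> Pow N. (-1) ^ card (N - S) * ?F {} (\<lambda>i. if i \<in> S then \<epsilon> k else 0)) / \<epsilon> k ^ card N)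
      \<longlonglongrightarrow> ?F N (\<lambda>_. 0)"
    \<comment> \<open>The Gaussian family is differentiable everywhere, so any positive \<delta>
      serves.\<close>
    by (rule mixed_difference_tendsto[where \<delta> = 1])
       (use assms in \<open>auto intro!: wick_cycle_sum_has_derivative wick_cycle_sum_tendsto simp del: fun_upd_apply\<close>)
  then show ?thesis by (simp add: wick_exp_def)
qed

text \<open>The quotient equals the top mixed derivative at some point of the unit cube, where the
  uniform bound applies.\<close>

lemma abs_wick_mixed_difference_le:
  fixes X :: "nat \<Rightarrow> real" and b :: "nat \<Rightarrow> nat \<Rightarrow> real" and \<epsilon> :: real
  assumes "finite N" and sym: "\<And>i j. b i j = b j i" and \<epsilon>: "0 < \<epsilon>" "\<epsilon> \<le> 1"
  shows "\<bar>(\<Sum>S \<in> Pow N. (-1) ^ card (N - S) * wick_exp N X b (\<lambda>i. if i \<in> S then \<epsilon> else 0)) / \<epsilon> ^ card N\<bar> \<le>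
    fact (card N) * exp ((card N + 1) * (1 + (\<Sum>i\<in>N. \<Sum>j\<in>N. \<bar>b i j\<bar>))) *
    exp ((card N + 1) * (\<Sum>i\<in>N. \<bar>X i\<bar>))"
proof -
  let ?F = "\<lambda>A t. cycle_sum (hermite_weight N X b t) A * wick_exp N X b t"
  have "((\<lambda>s. ?F A (t(a := s))) has_real_derivative ?F (insert a A) t) (at (t a))"
    if "insert a A \<subseteq> N" "a \<notin> A" for A a t
    using assms that by (intro wick_cycle_sum_has_derivative) auto
  from mixed_mean_value[OF \<open>finite N\<close> \<open>0 < \<epsilon>\<close>, of ?F, OF this] obtain \<xi> where
    \<xi>: "\<And>i. 0 \<le> \<xi> i \<and> \<xi> i \<le> \<epsilon>" and
    eq: "(\<Sum>S \<in> Pow N. (-1) ^ card (N - S) * ?F {} (\<lambda>i. if i \<in> S then \<epsilon> else 0)) = \<epsilon> ^ card N * ?F N \<xi>"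
    by auto
  have "(\<Sum>S \<in> Pow N. (-1) ^ card (N - S) * wick_exp N X b (\<lambda>i. if i \<in> S then \<epsilon> else 0)) / \<epsilon> ^ card N = ?F N \<xi>"
    using eq \<epsilon> by (simp add: field_simps)
  then show ?thesis
    using abs_wick_cycle_sum_le[OF \<open>finite N\<close>, of \<xi> X b] order_trans[OF conjunct2[OF \<xi>] \<epsilon>(2)] \<xi>
    by (simp only:)
qed

section \<open>The functionals as weighted sums\<close>

text \<open>Orbits are equivalence classes. The sum of their sizes later turns the sign exponent
  \<open>n - card (cycles n g)\<close> into a sum over the cycles.\<close>

lemma cycles_partition:
  assumes "g permutes {1..n}"
  shows "finite (cycles n g)" "\<And>c. c \<in> cycles n g \<Longrightarrow> c \<subseteq> {1..n} \<and> finite c \<and> 1 \<le> card c \<and> card c \<le> n"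
    "(\<Sum>c \<in> cycles n g. card c) = n"
proof -
  have perm: "permutation g"
    using assms by (auto simp: permutation_permutes)
  show "finite (cycles n g)" by (simp add: cycles_def)
  show c: "c \<subseteq> {1..n} \<and> finite c \<and> 1 \<le> card c \<and> card c \<le> n" if c: "c \<in> cycles n g" for c
  proof -
    obtain i where i: "c = orbit g i" "i \<in> {1..n}" using c unfolding cycles_def by blast
    then have "c \<subseteq> {1..n}" using permutes_orbit_subset[OF assms] by simp
    moreover from this have "finite c" by (rule finite_subset) simp
    moreover have "c \<noteq> {}" using i by (simp add: orbit_nonempty)
    ultimately show ?thesis
      using card_mono[of "{1..n}" c] by (simp add: Suc_le_eq card_gt_0_iff)
  qed
  have "\<Union> (cycles n g) = {1..n}"
    using permutation_self_in_orbit[OF perm] permutes_orbit_subset[OF assms] unfolding cycles_def by blast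
  moreover have "pairwise disjnt (cycles n g)"
    using orbit_permutes_eq_iff[OF assms finite_atLeastAtMost]
    unfolding pairwise_def disjnt_def cycles_def by blast
  ultimately show "(\<Sum>c \<in> cycles n g. card c) = n"
    using card_Union_disjoint[of "cycles n g"] c by simp
qed

lemma prod_fixed_points:
  "(\<Prod>i | {i} \<in> cycles_of_length n 1 g. v i) = (\<Prod>c \<in> cycles_of_length n 1 g. v (the_elem c))"
proof (rule prod.reindex_bij_witness[of _ "\<lambda>c. the_elem c" "\<lambda>i. {i}"])
  fix c assume "c \<in> cycles_of_length n 1 g"
  then have "card c = 1" by (simp add: cycles_of_length_def)
  then obtain i where "c = {i}" by (rule card_1_singletonE)
  then show "{the_elem c} = c" by simp
  with \<open>c \<in> cycles_of_length n 1 g\<close> show "the_elem c \<in> {i. {i} \<in> cycles_of_length n 1 g}" by simp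
qed auto

text \<open>A cycle of length at least three has weight zero, so only involutions survive in the sum
  over all permutations. At the origin their fixed points weigh \<open>W (f i) w\<close> and their
  pairs the negative inner product.\<close>

lemma hermite_functional_eq_cycle_sum:
  "hermite_functional M W n f w = cycle_sum
    (hermite_weight {1..n} (\<lambda>i. W (f i) w) (\<lambda>i j. l2_inner M (f i) (f j)) (\<lambda>_. 0)) {1..n}"
  (is "_ = cycle_sum ?v _")
proof -
  have "cycle_sum ?v {1..n} = (\<Sum>g | g permutes {1..n}. \<Prod>c \<in> cycles n g. ?v c)"
    by (simp add: cycle_sum_def cycles_def)
  also have "\<dots> = (\<Sum>g \<in> involutions n. \<Prod>c \<in> cycles n g. ?v c)"
  proof (intro sum.mono_neutral_right ballI)
    fix g assume g: "g \<in> {g. g permutes {1..n}} - involutions n"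
    then obtain c where "c \<in> cycles n g" "card c > 2" by (auto simp: involutions_def not_le)
    then have "c \<in> cycles n g" "?v c = 0" by (auto simp: hermite_weight_def)
    then show "(\<Prod>c \<in> cycles n g. ?v c) = 0"
      using cycles_partition(1) g by (intro prod_zero) auto
  qed (auto simp: involutions_def finite_permutations)
  also have "\<dots> = hermite_functional M W n f w"
    unfolding hermite_functional_def
  proof (intro sum.cong refl)
    fix g assume g: "g \<in> involutions n"
    note part = cycles_partition[of g n]
    have "cycles n g = cycles_of_length n 1 g \<union> cycles_of_length n 2 g"
      using g part(2) by (force simp: cycles_of_length_def involutions_def)
    moreover have "(\<Prod>c \<in> cycles_of_length n 1 g \<union> cycles_of_length n 2 g. ?v c) =
        (\<Prod>c \<in> cycles_of_length n 1 g. ?v c) * (\<Prod>c \<in> cycles_of_length n 2 g. ?v c)"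
      using g part(1) by (intro prod.union_disjoint) (auto simp: cycles_of_length_def involutions_def)
    ultimately have "(\<Prod>c \<in> cycles n g. ?v c) =
        (\<Prod>c \<in> cycles_of_length n 1 g. ?v c) * (\<Prod>c \<in> cycles_of_length n 2 g. ?v c)"
      by simp
    also have "(\<Prod>c \<in> cycles_of_length n 1 g. ?v c) = (\<Prod>c \<in> cycles_of_length n 1 g. W (f (the_elem c)) w)"
      by (intro prod.cong) (auto simp: cycles_of_length_def hermite_weight_def card_1_singleton_iff)
    also have "(\<Prod>c \<in> cycles_of_length n 2 g. ?v c) =
        (\<Prod>c \<in> cycles_of_length n 2 g. - l2_inner M (f (Min c)) (f (Max c)))"
      by (intro prod.cong) (auto simp: cycles_of_length_def hermite_weight_def)
    finally show "(\<Prod>c \<in> cycles n g. ?v c) = (\<Prod>i | {i} \<in> cycles_of_length n 1 g. W (f i) w) *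
        (\<Prod>c \<in> cycles_of_length n 2 g. - l2_inner M (f (Min c)) (f (Max c)))"
      by (simp only: prod_fixed_points)
  qed
  finally show ?thesis by simp
qed

text \<open>At the origin all denominators are 1. Since the cycle lengths add up to
  \<open>n\<close>, the sign of \<open>g\<close> is the product of
  \<open>(-1) ^ (card c - 1)\<close> over its cycles and is absorbed into the weights.\<close>

lemma charlier_functional_eq_cycle_sum:
  "charlier_functional M n f \<omega> = cycle_sum
    (charlier_weight {1..n} \<omega> f (\<lambda>i. \<integral>x. f i x \<partial>M) (\<lambda>_. 0)) {1..n}"
  (is "_ = cycle_sum ?v _")
proof -
  have "(-1) ^ (n - card (cycles n g)) *
       (\<Prod>i | {i} \<in> cycles_of_length n 1 g. (\<Sum>x\<in>\<omega>. f i x) - (\<integral>x. f i x \<partial>M)) *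
       (\<Prod>k = 2..n. \<Prod>c \<in> cycles_of_length n k g. \<Sum>x\<in>\<omega>. \<Prod>i\<in>c. f i x) = (\<Prod>c \<in> cycles n g. ?v c)"
    if g: "g permutes {1..n}" for g
  proof -
    let ?s = "\<lambda>c. (\<Sum>x\<in>\<omega>. \<Prod>i\<in>c. f i x) - (if card c = 1 then \<integral>x. f (the_elem c) x \<partial>M else 0)"
    note part = cycles_partition[OF g]
    have "n - card (cycles n g) = (\<Sum>c \<in> cycles n g. card c - 1)"
      using part by (subst sum_subtractf_nat) auto
    then have sign: "(-1) ^ (n - card (cycles n g)) = (\<Prod>c \<in> cycles n g. (-1::real) ^ (card c - 1))"
      by (simp add: power_sum)
    have "cycles n g = (\<Union>k \<in> {1..n}. cycles_of_length n k g)"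
      using part by (auto simp: cycles_of_length_def)
    moreover have "(\<Prod>c \<in> (\<Union>k \<in> {1..n}. cycles_of_length n k g). ?s c) =
        (\<Prod>k = 1..n. \<Prod>c \<in> cycles_of_length n k g. ?s c)"
      using part(1) by (intro prod.UNION_disjoint) (auto simp: cycles_of_length_def)
    ultimately have "(\<Prod>c \<in> cycles n g. ?s c) = (\<Prod>k = 1..n. \<Prod>c \<in> cycles_of_length n k g. ?s c)"
      by simp
    also have "\<dots> = (\<Prod>c \<in> cycles_of_length n 1 g. ?s c) * (\<Prod>k = 2..n. \<Prod>c \<in> cycles_of_length n k g. ?s c)"
    \<comment> \<open>For \<open>n = 0\<close> there is no factor of length 1 to split off; both
      sides are empty products.\<close>
    proof (cases "n = 0")
      case True
      then show ?thesis by (simp add: cycles_of_length_def cycles_def)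
    next
      case False
      then show ?thesis
        using prod.atLeast_Suc_atMost[of 1 n "\<lambda>k. \<Prod>c \<in> cycles_of_length n k g. ?s c"]
        by (simp only: Suc_1)
    qed
    also have "(\<Prod>c \<in> cycles_of_length n 1 g. ?s c) =
        (\<Prod>c \<in> cycles_of_length n 1 g. (\<Sum>x\<in>\<omega>. f (the_elem c) x) - (\<integral>x. f (the_elem c) x \<partial>M))"
      by (intro prod.cong) (auto simp: cycles_of_length_def card_1_singleton_iff)
    also have "(\<Prod>k = 2..n. \<Prod>c \<in> cycles_of_length n k g. ?s c) =
        (\<Prod>k = 2..n. \<Prod>c \<in> cycles_of_length n k g. \<Sum>x\<in>\<omega>. \<Prod>i\<in>c. f i x)"
      by (intro prod.cong) (auto simp: cycles_of_length_def)
    finally have "(\<Prod>i | {i} \<in> cycles_of_length n 1 g. (\<Sum>x\<in>\<omega>. f i x) - (\<integral>x. f i x \<partial>M)) *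
       (\<Prod>k = 2..n. \<Prod>c \<in> cycles_of_length n k g. \<Sum>x\<in>\<omega>. \<Prod>i\<in>c. f i x) = (\<Prod>c \<in> cycles n g. ?s c)"
      by (simp only: prod_fixed_points)
    moreover have "?v c = (-1) ^ (card c - 1) * ?s c" for c
      by (simp add: charlier_weight_def)
    ultimately show ?thesis
      by (simp add: sign prod.distrib mult.assoc)
  qed
  then have "charlier_functional M n f \<omega> = (\<Sum>g | g permutes {1..n}. \<Prod>c \<in> cycles n g. ?v c)"
    unfolding charlier_functional_def by (intro sum.cong) auto
  then show ?thesis by (simp add: cycle_sum_def cycles_def)
qed

section \<open>Measurability of functionals on the configuration space\<close>

lemma
  assumes "poisson_process M Q"
  shows space_poisson: "space Q = configurations M"
    and sets_poisson: "sets Q = sigma_sets (configurations M)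
      {{\<omega> \<in> configurations M. card (\<omega> \<inter> A) = k} | A k. A \<in> sets M}"
  using assms unfolding poisson_process_def by blast+

lemma poisson_count_measurable:
  assumes Q: "poisson_process M Q" and A: "A \<in> sets M"
  shows "(\<lambda>\<omega>. real (card (\<omega> \<inter> A))) \<in> borel_measurable Q"
proof -
  have "(\<lambda>\<omega>. card (\<omega> \<inter> A)) \<in> Q \<rightarrow>\<^sub>M count_space UNIV"
  proof (subst measurable_count_space_eq2_countable, intro conjI ballI)
    fix k :: nat
    have "(\<lambda>\<omega>. card (\<omega> \<inter> A)) -` {k} \<inter> space Q = {\<omega> \<in> configurations M. card (\<omega> \<inter> A) = k}"
      using space_poisson[OF Q] by auto
    also have "\<dots> \<in> sets Q"
      unfolding sets_poisson[OF Q] using A by (intro sigma_sets.Basic) auto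
    finally show "(\<lambda>\<omega>. card (\<omega> \<inter> A)) -` {k} \<inter> space Q \<in> sets Q" .
  qed auto
  then show ?thesis by simp
qed

text \<open>For a simple function the sum over a configuration is a finite combination of counts of
  level sets. Configurations are finite, so pointwise approximation by simple functions passes to
  the sums.\<close>

lemma poisson_sum_measurable:
  fixes f :: "'a \<Rightarrow> real"
  assumes Q: "poisson_process M Q" and f: "f \<in> borel_measurable M"
  shows "(\<lambda>\<omega>. \<Sum>x\<in>\<omega>. f x) \<in> borel_measurable Q"
proof -
  obtain F where F: "\<And>i. simple_function M (F i)" "\<And>x. x \<in> space M \<Longrightarrow> (\<lambda>i. F i x) \<longlonglongrightarrow> f x"
    using borel_measurable_implies_sequence_metric[OF f, of 0] by blast
  have space: "finite \<omega>" "\<omega> \<subseteq> space M" if "\<omega> \<in> space Q" for \<omega>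
    using that space_poisson[OF Q] by (auto simp: configurations_def)
  show ?thesis
  proof (rule borel_measurable_LIMSEQ_real)
    show "(\<lambda>i. \<Sum>x\<in>\<omega>. F i x) \<longlonglongrightarrow> (\<Sum>x\<in>\<omega>. f x)" if "\<omega> \<in> space Q" for \<omega>
      using space(2)[OF that] by (intro tendsto_sum F) auto
    fix i
    let ?A = "\<lambda>y. F i -` {y} \<inter> space M"
    have "(\<lambda>\<omega>. \<Sum>y \<in> F i ` space M. y * real (card (\<omega> \<inter> ?A y))) \<in> borel_measurable Q"
      using simple_functionD(2)[OF F(1)]
      by (intro borel_measurable_sum borel_measurable_times poisson_count_measurable[OF Q]) auto
    moreover have "(\<Sum>y \<in> F i ` space M. y * real (card (\<omega> \<inter> ?A y))) = (\<Sum>x\<in>\<omega>. F i x)"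
      if "\<omega> \<in> space Q" for \<omega>
    proof -
      have "(\<Sum>x\<in>\<omega>. F i x) = (\<Sum>y \<in> F i ` space M. \<Sum>x | x \<in> \<omega> \<and> F i x = y. F i x)"
        using space[OF that] simple_functionD(1)[OF F(1)] by (intro sum.group[symmetric]) auto
      also have "\<dots> = (\<Sum>y \<in> F i ` space M. \<Sum>x \<in> \<omega> \<inter> ?A y. y)"
        using space[OF that] by (intro sum.cong) auto
      finally show ?thesis by (simp add: mult.commute)
    qed
    ultimately show "(\<lambda>\<omega>. \<Sum>x\<in>\<omega>. F i x) \<in> borel_measurable Q"
      by (simp cong: measurable_cong)
  qed
qed

lemma charlier_functional_measurable:
  assumes Q: "poisson_process M Q" and f: "\<And>i. i \<in> {1..n} \<Longrightarrow> f i \<in> borel_measurable M"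
  shows "charlier_functional M n f \<in> borel_measurable Q"
proof -
  have weight: "(\<lambda>\<omega>. charlier_weight {1..n} \<omega> f m (\<lambda>_. 0) c) \<in> borel_measurable Q"
    if c: "c \<subseteq> {1..n}" for m c
  proof -
    have "(\<lambda>x. \<Prod>i\<in>c. f i x) \<in> borel_measurable M"
      using c by (intro borel_measurable_prod f) blast
    then have "(\<lambda>\<omega>. \<Sum>x\<in>\<omega>. \<Prod>i\<in>c. f i x) \<in> borel_measurable Q"
      by (rule poisson_sum_measurable[OF Q])
    then show ?thesis
      by (simp add: charlier_weight_def)
  qed
  have "(\<lambda>\<omega>. cycle_sum (charlier_weight {1..n} \<omega> f (\<lambda>i. \<integral>x. f i x \<partial>M) (\<lambda>_. 0)) {1..n}) \<in> borel_measurable Q"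
    unfolding cycle_sum_def
  proof (intro borel_measurable_sum borel_measurable_prod weight)
    fix g c assume "g \<in> {g. g permutes {1..n}}" "c \<in> orbit g ` {1..n}"
    then show "c \<subseteq> {1..n}" using permutes_orbit_subset[of g "{1..n}"] by blast
  qed
  then show ?thesis
    by (simp only: charlier_functional_eq_cycle_sum[symmetric] cong: measurable_cong)
qed

section \<open>Square integrable functions and isometries\<close>

lemma L2_lincomb:
  fixes F G :: "'a \<Rightarrow> 'b::{real_normed_field, second_countable_topology}"
  assumes "F \<in> L2 M" "G \<in> L2 M"
  shows "(\<lambda>x. a * F x + b * G x) \<in> L2 M"
proof -
  have [measurable]: "F \<in> borel_measurable M" "G \<in> borel_measurable M"
    and int: "integrable M (\<lambda>x. (norm (F x))\<^sup>2)" "integrable M (\<lambda>x. (norm (G x))\<^sup>2)"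
    using assms by (simp_all add: L2_def)
  have "integrable M (\<lambda>x. 2 * (norm a)\<^sup>2 * (norm (F x))\<^sup>2 + 2 * (norm b)\<^sup>2 * (norm (G x))\<^sup>2)"
    using int by simp
  then have "integrable M (\<lambda>x. (norm (a * F x + b * G x))\<^sup>2)"
  proof (rule Bochner_Integration.integrable_bound)
    have "(norm (a * F x + b * G x))\<^sup>2 \<le> 2 * (norm a)\<^sup>2 * (norm (F x))\<^sup>2 + 2 * (norm b)\<^sup>2 * (norm (G x))\<^sup>2" for x
    proof -
      have "(norm (a * F x + b * G x))\<^sup>2 \<le> (norm a * norm (F x) + norm b * norm (G x))\<^sup>2"
        using norm_triangle_ineq[of "a * F x" "b * G x"] by (intro power_mono) (simp_all add: norm_mult)
      also have "\<dots> \<le> 2 * (norm a * norm (F x))\<^sup>2 + 2 * (norm b * norm (G x))\<^sup>2"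
        using sum_squares_bound[of "norm a * norm (F x)" "norm b * norm (G x)"] by (simp add: power2_sum)
      finally show ?thesis by (simp add: power_mult_distrib)
    qed
    then show "AE x in M. norm ((norm (a * F x + b * G x))\<^sup>2) \<le>
        norm (2 * (norm a)\<^sup>2 * (norm (F x))\<^sup>2 + 2 * (norm b)\<^sup>2 * (norm (G x))\<^sup>2)"
      by (intro always_eventually allI) (auto intro: order_trans)
  qed measurable
  then show ?thesis by (simp add: L2_def)
qed

lemma L2_sum:
  fixes F :: "'i \<Rightarrow> 'a \<Rightarrow> 'b::{real_normed_field, second_countable_topology}"
  assumes "finite A" "\<And>i. i \<in> A \<Longrightarrow> F i \<in> L2 M"
  shows "(\<lambda>x. \<Sum>i\<in>A. c i * F i x) \<in> L2 M"
  using assms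
proof (induction A rule: finite_induct)
  case empty
  show ?case by (simp add: L2_def)
next
  case (insert i A)
  then have "(\<lambda>x. c i * F i x + 1 * (\<Sum>i\<in>A. c i * F i x)) \<in> L2 M"
    by (intro L2_lincomb) auto
  with insert show ?case by simp
qed

lemma L2_integrable_mult:
  fixes f g :: "'a \<Rightarrow> real"
  assumes "f \<in> L2 M" "g \<in> L2 M"
  shows "integrable M (\<lambda>x. f x * g x)"
proof (rule Bochner_Integration.integrable_bound)
  show "integrable M (\<lambda>x. (f x)\<^sup>2 + (g x)\<^sup>2)"
    using assms by (simp add: L2_def)
  have "\<bar>f x * g x\<bar> \<le> (f x)\<^sup>2 + (g x)\<^sup>2" for x
    using sum_squares_bound[of "\<bar>f x\<bar>" "\<bar>g x\<bar>"] mult_nonneg_nonneg[of "\<bar>f x\<bar>" "\<bar>g x\<bar>"]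
    unfolding abs_mult power2_abs by linarith
  then show "AE x in M. norm (f x * g x) \<le> norm ((f x)\<^sup>2 + (g x)\<^sup>2)"
    by (simp add: abs_mult)
qed (use assms in \<open>auto simp: L2_def intro!: borel_measurable_times\<close>)

lemma (in finite_measure) L2_integrable:
  fixes f :: "'a \<Rightarrow> real"
  assumes "f \<in> L2 M"
  shows "integrable M f"
proof -
  have "(\<lambda>_. 1::real) \<in> L2 M" by (simp add: L2_def)
  from L2_integrable_mult[OF assms this] show ?thesis by simp
qed

lemma l2_inner_sum:
  fixes f :: "'i \<Rightarrow> 'a \<Rightarrow> real" and t :: "'i \<Rightarrow> real"
  assumes "finite A" and f: "\<And>i. i \<in> A \<Longrightarrow> f i \<in> L2 M"
  shows "l2_inner M (\<lambda>x. \<Sum>i\<in>A. t i * f i x) (\<lambda>x. \<Sum>i\<in>A. t i * f i x) =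
    (\<Sum>i\<in>A. \<Sum>j\<in>A. l2_inner M (f i) (f j) * t i * t j)"
proof -
  have "(\<Sum>i\<in>A. t i * f i x) * (\<Sum>i\<in>A. t i * f i x) = (\<Sum>i\<in>A. \<Sum>j\<in>A. (t i * t j) * (f i x * f j x))" for x
    unfolding sum_product by (intro sum.cong refl) (simp add: mult_ac)
  moreover have "integrable M (\<lambda>x. (t i * t j) * (f i x * f j x))" if "i \<in> A" "j \<in> A" for i j
    using that by (intro integrable_mult_right L2_integrable_mult f)
  ultimately show ?thesis
    unfolding l2_inner_def by (simp add: mult_ac)
qed

lemma L2_isometry_linear:
  fixes a b :: complex
  assumes "L2_isometry P Q \<Phi>" "F \<in> L2 P" "G \<in> L2 P"
  shows "AE y in Q. \<Phi> (\<lambda>x. a * F x + b * G x) y = a * \<Phi> F y + b * \<Phi> G y"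
  using assms unfolding L2_isometry_def by blast

lemma L2_isometry_sum:
  fixes c :: "'i \<Rightarrow> complex"
  assumes \<Phi>: "L2_isometry P Q \<Phi>" and "finite A" "\<And>i. i \<in> A \<Longrightarrow> F i \<in> L2 P"
  shows "AE y in Q. \<Phi> (\<lambda>x. \<Sum>i\<in>A. c i * F i x) y = (\<Sum>i\<in>A. c i * \<Phi> (F i) y)"
  using assms(2,3)
proof (induction A rule: finite_induct)
  case empty
  have "(\<lambda>_. 0) \<in> L2 P" by (simp add: L2_def)
  \<comment> \<open>Linearity with both coefficients zero shows that zero is sent to zero almost
    everywhere.\<close>
  from L2_isometry_linear[OF \<Phi> this this, of 0 0] show ?case by simp
next
  case (insert i A)
  have "F i \<in> L2 P" "(\<lambda>x. \<Sum>i\<in>A. c i * F i x) \<in> L2 P"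
    using insert by (auto intro: L2_sum)
  then have "AE y in Q. \<Phi> (\<lambda>x. c i * F i x + 1 * (\<Sum>i\<in>A. c i * F i x)) y =
      c i * \<Phi> (F i) y + 1 * \<Phi> (\<lambda>x. \<Sum>i\<in>A. c i * F i x) y"
    by (rule L2_isometry_linear[OF \<Phi>])
  moreover have "AE y in Q. \<Phi> (\<lambda>x. \<Sum>i\<in>A. c i * F i x) y = (\<Sum>i\<in>A. c i * \<Phi> (F i) y)"
    using insert by auto
  ultimately show ?case
    using insert.hyps by (auto elim: eventually_elim2)
qed

text \<open>The isometry carries the mean square convergence of \<open>D k\<close> to
  \<open>H\<close> over to the images, which gives almost everywhere convergence along a
  subsequence. Where the images also converge pointwise, the limits coincide.\<close>

lemma L2_isometry_limit:
  fixes C :: "'b \<Rightarrow> complex"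
  assumes \<Phi>: "L2_isometry P Q \<Phi>" and H: "H \<in> L2 P" and D: "\<And>k::nat. D k \<in> L2 P"
    and conv: "(\<lambda>k. \<integral>x. (norm (H x - D k x))\<^sup>2 \<partial>P) \<longlonglongrightarrow> 0"
    and lim: "AE y in Q. (\<lambda>k. \<Phi> (D k) y) \<longlonglongrightarrow> C y"
  shows "AE y in Q. \<Phi> H y = C y"
proof -
  \<comment> \<open>The difference is spelled with coefficients 1 and -1 to match the linearity
    clause of \<open>L2_isometry\<close>.\<close>
  let ?d = "\<lambda>k. \<Phi> (\<lambda>x. 1 * H x + (-1) * D k x)"
  have dL2: "(\<lambda>x. 1 * H x + (-1) * D k x) \<in> L2 P" for k
    by (rule L2_lincomb[OF H D])
  then have "?d k \<in> L2 Q" for k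
    using \<Phi> unfolding L2_isometry_def by blast
  then have int: "integrable Q (\<lambda>y. (norm (?d k y))\<^sup>2)" for k
    by (simp add: L2_def)
  have "(\<integral>y. norm ((norm (?d k y))\<^sup>2) \<partial>Q) = (\<integral>x. (norm (H x - D k x))\<^sup>2 \<partial>P)" for k
  proof -
    have "(\<integral>y. (norm (?d k y))\<^sup>2 \<partial>Q) = (\<integral>x. (norm (1 * H x + (-1) * D k x))\<^sup>2 \<partial>P)"
      using \<Phi> dL2[of k] unfolding L2_isometry_def by blast
    then show ?thesis by simp
  qed
  then have "(\<lambda>k. \<integral>y. norm ((norm (?d k y))\<^sup>2) \<partial>Q) \<longlonglongrightarrow> 0"
    using conv by simp
  from tendsto_L1_AE_subseq[OF int this] obtain r where r: "strict_mono r"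
    and sub: "AE y in Q. (\<lambda>k. (norm (?d (r k) y))\<^sup>2) \<longlonglongrightarrow> 0"
    by blast
  have "AE y in Q. ?d k y = 1 * \<Phi> H y + (-1) * \<Phi> (D k) y" for k
    by (rule L2_isometry_linear[OF \<Phi> H D])
  then have "AE y in Q. \<forall>k. ?d k y = 1 * \<Phi> H y + (-1) * \<Phi> (D k) y"
    unfolding AE_all_countable by blast
  with sub lim show ?thesis
  proof eventually_elim
    case (elim y)
    have "(\<lambda>k. (norm (\<Phi> H y - \<Phi> (D (r k)) y))\<^sup>2) \<longlonglongrightarrow> (norm (\<Phi> H y - C y))\<^sup>2"
      using LIMSEQ_subseq_LIMSEQ[OF elim(2) r] by (intro tendsto_intros) (simp add: o_def)
    moreover have "(\<lambda>k. (norm (\<Phi> H y - \<Phi> (D (r k)) y))\<^sup>2) \<longlonglongrightarrow> 0"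
      using elim(1,3) by simp
    ultimately have "(norm (\<Phi> H y - C y))\<^sup>2 = 0"
      by (rule LIMSEQ_unique)
    then show ?case by simp
  qed
qed

section \<open>Exponential moments of white noise\<close>

lemma white_noise_measurable:
  assumes "gaussian_white_noise M P W" "h \<in> L2 M"
  shows "W h \<in> borel_measurable P"
proof (rule measurableI)
  fix B :: "real set" assume B: "B \<in> sets borel"
  have "sets P = sigma_sets (space P) {W h -` B \<inter> space P | h B. h \<in> L2 M \<and> B \<in> sets borel}"
    using assms(1) unfolding gaussian_white_noise_def by blast
  then show "W h -` B \<inter> space P \<in> sets P"
    using B assms(2) by (metis (mono_tags, lifting) mem_Collect_eq sigma_sets.Basic)
qed simp

lemma white_noise_linear:
  fixes a b :: real
  assumes "gaussian_white_noise M P W" "g \<in> L2 M" "h \<in> L2 M"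
  shows "AE w in P. W (\<lambda>x. a * g x + b * h x) w = a * W g w + b * W h w"
  using assms unfolding gaussian_white_noise_def by blast

lemma white_noise_sum:
  fixes f :: "'i \<Rightarrow> 'a \<Rightarrow> real" and c :: "'i \<Rightarrow> real"
  assumes W: "gaussian_white_noise M P W" and "finite A" "\<And>i. i \<in> A \<Longrightarrow> f i \<in> L2 M"
  shows "AE w in P. W (\<lambda>x. \<Sum>i\<in>A. c i * f i x) w = (\<Sum>i\<in>A. c i * W (f i) w)"
  using assms(2,3)
proof (induction A rule: finite_induct)
  case empty
  have "(\<lambda>_. 0) \<in> L2 M" by (simp add: L2_def)
  from white_noise_linear[OF W this this, of 0 0] show ?case by simp
next
  case (insert i A)
  have "f i \<in> L2 M" "(\<lambda>x. \<Sum>i\<in>A. c i * f i x) \<in> L2 M"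
    using insert by (auto intro: L2_sum)
  then have "AE w in P. W (\<lambda>x. c i * f i x + 1 * (\<Sum>i\<in>A. c i * f i x)) w =
      c i * W (f i) w + 1 * W (\<lambda>x. \<Sum>i\<in>A. c i * f i x) w"
    by (rule white_noise_linear[OF W])
  moreover have "AE w in P. W (\<lambda>x. \<Sum>i\<in>A. c i * f i x) w = (\<Sum>i\<in>A. c i * W (f i) w)"
    using insert by auto
  ultimately show ?case
    using insert.hyps by (auto elim: eventually_elim2)
qed

text \<open>The defining identity gives the characteristic function of \<open>W h\<close> at 1 only;
  applying it to \<open>t * h x\<close> and using linearity gives it at every \<open>t\<close>, and
  Levy's uniqueness theorem identifies the law. A scaled standard normal variable also covers norm
  zero.\<close>

lemma white_noise_distr:
  assumes W: "gaussian_white_noise M P W" and h: "h \<in> L2 M"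
  shows "distr P borel (W h) = distr std_normal_distribution borel (\<lambda>x. sqrt (l2_inner M h h) * x)"
proof -
  interpret prob_space P using W unfolding gaussian_white_noise_def by blast
  interpret N: real_distribution std_normal_distribution by (rule real_dist_normal_dist)
  note [measurable] = white_noise_measurable[OF W h]
  let ?s = "sqrt (l2_inner M h h)"
  have "char (distr P borel (W h)) t = char (distr std_normal_distribution borel (\<lambda>x. ?s * x)) t" for t
  proof -
    have th: "(\<lambda>x. t * h x) \<in> L2 M"
      using L2_lincomb[OF h h, of t 0] by simp
    note [measurable] = white_noise_measurable[OF W th]
    have "AE w in P. W (\<lambda>x. t * h x + 0 * h x) w = t * W h w + 0 * W h w"
      by (rule white_noise_linear[OF W h h])
    then have "char (distr P borel (W h)) t = (\<integral>w. exp (\<i> * complex_of_real (W (\<lambda>x. t * h x) w)) \<partial>P)"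
      unfolding char_def by (subst integral_distr) (auto intro!: integral_cong_AE)
    also have "\<dots> = complex_of_real (exp (- l2_inner M (\<lambda>x. t * h x) (\<lambda>x. t * h x) / 2))"
      using W th unfolding gaussian_white_noise_def by blast
    also have "l2_inner M (\<lambda>x. t * h x) (\<lambda>x. t * h x) = (t * ?s)\<^sup>2"
    proof -
      have "0 \<le> l2_inner M h h" unfolding l2_inner_def by simp
      moreover have "l2_inner M (\<lambda>x. t * h x) (\<lambda>x. t * h x) = (\<integral>x. t\<^sup>2 * (h x * h x) \<partial>M)"
        unfolding l2_inner_def by (simp add: power2_eq_square mult_ac)
      ultimately show ?thesis by (simp add: l2_inner_def power_mult_distrib)
    qed
    also have "complex_of_real (exp (- (t * ?s)\<^sup>2 / 2)) = char std_normal_distribution (t * ?s)"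
      by (simp add: char_std_normal_distribution)
    also have "\<dots> = char (distr std_normal_distribution borel (\<lambda>x. ?s * x)) t"
      unfolding char_def by (subst integral_distr) (auto simp: mult.assoc)
    finally show ?thesis .
  qed
  then show ?thesis
    by (intro Levy_uniqueness real_distribution_distr N.real_distribution_distr ext) simp_all
qed

text \<open>Completing the square turns \<open>exp (a * x)\<close> times the standard density into a
  multiple of the normal density with mean \<open>a\<close>. The absolute value is handled by adding
  the cases \<open>c\<close> and \<open>- c\<close>.\<close>

lemma integrable_std_normal_exp_abs:
  fixes c :: real
  shows "integrable std_normal_distribution (\<lambda>x. exp (c * \<bar>x\<bar>))"
proof -
  have "integrable std_normal_distribution (\<lambda>x. exp (a * x))" for a
  proof -
    have "std_normal_density x * exp (a * x) = exp (a\<^sup>2 / 2) * normal_density a 1 x" for x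
      by (simp add: normal_density_def exp_add[symmetric] exp_diff[symmetric] power2_diff field_simps)
    then show ?thesis
      by (subst integrable_density) auto
  qed
  from Bochner_Integration.integrable_add[OF this[of c] this[of "- c"]] show ?thesis
  proof (rule Bochner_Integration.integrable_bound)
    have "norm (exp (c * \<bar>x\<bar>)) \<le> norm (exp (c * x) + exp (- c * x))" for x
      by (cases "x \<ge> 0") (auto simp: add_increasing add_increasing2)
    then show "AE x in std_normal_distribution. norm (exp (c * \<bar>x\<bar>)) \<le> norm (exp (c * x) + exp (- c * x))"
      by simp
  qed simp
qed

lemma white_noise_integrable_exp_abs:
  fixes c :: real
  assumes W: "gaussian_white_noise M P W" and h: "h \<in> L2 M"
  shows "integrable P (\<lambda>w. exp (c * \<bar>W h w\<bar>))"
proof -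
  note [measurable] = white_noise_measurable[OF W h]
  let ?s = "sqrt (l2_inner M h h)"
  have "0 \<le> ?s" unfolding l2_inner_def by simp
  then have "integrable (distr std_normal_distribution borel (\<lambda>x. ?s * x)) (\<lambda>x. exp (c * \<bar>x\<bar>))"
    using integrable_std_normal_exp_abs[of "c * ?s"]
    by (subst integrable_distr_eq) (simp_all add: abs_mult mult.assoc)
  then show ?thesis
    unfolding white_noise_distr[OF W h, symmetric] by (subst (asm) integrable_distr_eq) auto
qed

text \<open>The variables may be dependent, so instead of factoring,
  \<open>exp (c * (x + y))\<close> is bounded by \<open>exp (2 * c * x) + exp (2 * c * y)\<close>.
  The constant doubles at each step, hence the induction for arbitrary \<open>c\<close>.\<close>

lemma white_noise_integrable_exp_sum:
  fixes f :: "'i \<Rightarrow> 'a \<Rightarrow> real" and c :: real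
  assumes W: "gaussian_white_noise M P W" and "finite A" "\<And>i. i \<in> A \<Longrightarrow> f i \<in> L2 M"
  shows "integrable P (\<lambda>w. exp (c * (\<Sum>i\<in>A. \<bar>W (f i) w\<bar>)))"
  using assms(2,3)
proof (induction A arbitrary: c rule: finite_induct)
  case empty
  interpret prob_space P using W unfolding gaussian_white_noise_def by blast
  show ?case by simp
next
  case (insert i A)
  have [measurable]: "W (f j) \<in> borel_measurable P" if "j \<in> insert i A" for j
    using white_noise_measurable[OF W] insert.prems that by blast
  have [measurable]: "W (f i) \<in> borel_measurable P" by simp
  have m: "(\<lambda>w. \<Sum>j\<in>A. \<bar>W (f j) w\<bar>) \<in> borel_measurable P"
    by (intro borel_measurable_sum) simp
  have "integrable P (\<lambda>w. exp (2 * c * \<bar>W (f i) w\<bar>) + exp (2 * c * (\<Sum>j\<in>A. \<bar>W (f j) w\<bar>)))"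
    using insert by (intro Bochner_Integration.integrable_add white_noise_integrable_exp_abs[OF W]) auto
  then show ?case
  proof (rule Bochner_Integration.integrable_bound)
    have "exp (c * (x + y)) \<le> exp (2 * c * x) + exp (2 * c * y)" for x y :: real
    proof (cases "c * x \<le> c * y")
      case True
      then have "exp (c * (x + y)) \<le> exp (2 * c * y)" by (simp add: algebra_simps)
      then show ?thesis by (simp add: add_increasing)
    next
      case False
      then have "exp (c * (x + y)) \<le> exp (2 * c * x)" by (simp add: algebra_simps)
      then show ?thesis by (simp add: add_increasing2)
    qed
    then show "AE w in P. norm (exp (c * (\<Sum>j\<in>insert i A. \<bar>W (f j) w\<bar>))) \<le>
        norm (exp (2 * c * \<bar>W (f i) w\<bar>) + exp (2 * c * (\<Sum>j\<in>A. \<bar>W (f j) w\<bar>)))"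
      using insert.hyps by simp
  qed (use m insert.hyps in simp)
qed

lemma white_noise_exp_L2:
  fixes c :: real
  assumes W: "gaussian_white_noise M P W" and h: "h \<in> L2 M"
  shows "(\<lambda>w. complex_of_real (exp (W h w - c))) \<in> L2 P"
proof -
  note [measurable] = white_noise_measurable[OF W h]
  have "integrable P (\<lambda>w. exp (- 2 * c) * exp (2 * \<bar>W h w\<bar>))"
    by (intro integrable_mult_right white_noise_integrable_exp_abs[OF W h])
  then have "integrable P (\<lambda>w. (norm (complex_of_real (exp (W h w - c))))\<^sup>2)"
    by (rule Bochner_Integration.integrable_bound) (auto simp: exp_add[symmetric] exp_double[symmetric] power2_eq_square)
  then show ?thesis by (simp add: L2_def)
qed

lemma l2_inner_commute: "l2_inner M f g = l2_inner M g f"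
  by (simp add: l2_inner_def mult.commute)

theorem corollary2:
  fixes M :: "'a measure"
    and P :: "'w measure"
    and W :: "('a \<Rightarrow> real) \<Rightarrow> 'w \<Rightarrow> real"
    and Q :: "'a set measure"
    and \<Phi> :: "('w \<Rightarrow> complex) \<Rightarrow> 'a set \<Rightarrow> complex"
    and n :: nat
    and f :: "nat \<Rightarrow> 'a \<Rightarrow> real"
  assumes "continuous_lebesgue_space M"
    and "gaussian_white_noise M P W"
    and "poisson_process M Q"
    and "L2_isometry P Q \<Phi>"
    and "\<And>h. h \<in> L2 M \<Longrightarrow>
      AE \<omega> in Q. \<Phi> (\<lambda>w. complex_of_real (exp (W h w - l2_inner M h h / 2))) \<omega>
        = complex_of_real ((\<Prod>x\<in>\<omega>. 1 + h x) * exp (- (\<integral>x. h x \<partial>M)))"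
    and "n \<ge> 1"
    and "\<And>i. i \<in> {1..n} \<Longrightarrow> f i \<in> L2 M"
  shows "(\<lambda>w. complex_of_real (hermite_functional M W n f w)) \<in> L2 P \<and>
    (\<lambda>\<omega>. complex_of_real (charlier_functional M n f \<omega>)) \<in> L2 Q \<and>
    (AE \<omega> in Q. \<Phi> (\<lambda>w. complex_of_real (hermite_functional M W n f w)) \<omega>
      = complex_of_real (charlier_functional M n f \<omega>))"
proof -
  interpret finite_measure M using assms(1) by (simp add: continuous_lebesgue_space_def)
  note W = assms(2) and Q = assms(3) and \<Phi> = assms(4) and f = assms(7)
  define N where "N = {1..n}"
  have N: "finite N" "card N = n" by (simp_all add: N_def)
  have fN: "f i \<in> L2 M" if "i \<in> N" for i using f that by (simp add: N_def)
  define b where "b = (\<lambda>i j. l2_inner M (f i) (f j))"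
  define m where "m = (\<lambda>i. \<integral>x. f i x \<partial>M)"
  define X where "X = (\<lambda>w i. W (f i) w)"
  have sym: "b i j = b j i" for i j by (simp add: b_def l2_inner_commute)
  \<comment> \<open>Steps of at most 1 keep the cubes inside the unit cube, where the Gaussian bound
    holds for every \<open>k\<close>.\<close>
  define \<epsilon> where "\<epsilon> = (\<lambda>k. 1 / real (Suc k))"
  have \<epsilon>: "\<epsilon> \<longlonglongrightarrow> 0" "\<And>k. 0 < \<epsilon> k" "\<And>k. \<epsilon> k \<le> 1"
    unfolding \<epsilon>_def using LIMSEQ_inverse_real_of_nat by (simp_all add: inverse_eq_divide)
  define t where "t = (\<lambda>(k::nat) S (i::nat). if i \<in> S then \<epsilon> k else 0)"
  define h where "h = (\<lambda>k S x. \<Sum>i\<in>N. t k S i * f i x)"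
  define E where "E = (\<lambda>k S w. exp (W (h k S) w - l2_inner M (h k S) (h k S) / 2))"
  define c where "c = (\<lambda>k S. (-1) ^ card (N - S) / \<epsilon> k ^ n)"
  \<comment> \<open>\<open>D k\<close> combines the normalised exponentials themselves, whose images
    are known; \<open>\<Delta> k\<close> replaces the noise of a linear combination by the linear
    combination of the noises. The two are identified almost everywhere, the noise being linear up
    to null sets.\<close>
  define D where "D = (\<lambda>k w. \<Sum>S \<in> Pow N. complex_of_real (c k S) * complex_of_real (E k S w))"
  define \<Delta> where "\<Delta> = (\<lambda>k w. (\<Sum>S \<in> Pow N. (-1) ^ card (N - S) * wick_exp N (X w) b (t k S)) / \<epsilon> k ^ n)"
  define H where "H = (\<lambda>w. hermite_functional M W n f w)"
  define C where "C = (\<lambda>\<omega>. charlier_functional M n f \<omega>)"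
  have hL2: "h k S \<in> L2 M" for k S
    unfolding h_def by (intro L2_sum N fN)
  have EL2: "(\<lambda>w. complex_of_real (E k S w)) \<in> L2 P" for k S
    unfolding E_def by (intro white_noise_exp_L2[OF W] hL2)
  have DL2: "D k \<in> L2 P" for k
    unfolding D_def using N EL2 by (intro L2_sum) auto
  have Xm [measurable]: "(\<lambda>w. X w i) \<in> borel_measurable P" if "i \<in> N" for i
    unfolding X_def using white_noise_measurable[OF W fN[OF that]] by simp

  \<comment> \<open>Gaussian side: mean square convergence to the Hermite functional\<close>
  have "AE w in P. E k S w = wick_exp N (X w) b (t k S)" for k S
  proof -
    have "l2_inner M (h k S) (h k S) = (\<Sum>i\<in>N. \<Sum>j\<in>N. b i j * t k S i * t k S j)"
      unfolding h_def b_def using N(1) fN by (rule l2_inner_sum)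
    moreover have "AE w in P. W (h k S) w = (\<Sum>i\<in>N. t k S i * X w i)"
      unfolding h_def X_def using N(1) fN by (rule white_noise_sum[OF W])
    ultimately show ?thesis
      unfolding E_def wick_exp_def by simp
  qed
  then have wick: "AE w in P. \<forall>S \<in> Pow N. E k S w = wick_exp N (X w) b (t k S)" for k
    using N by (intro AE_finite_allI) auto
  have D\<Delta>: "AE w in P. D k w = complex_of_real (\<Delta> k w)" for k
    using wick[of k] by eventually_elim (simp add: D_def \<Delta>_def c_def sum_divide_distrib)
  have H: "H w = cycle_sum (hermite_weight N (X w) b (\<lambda>_. 0)) N" for w
    unfolding H_def hermite_functional_eq_cycle_sum N_def X_def b_def ..
  have \<Delta>H: "(\<lambda>k. \<Delta> k w) \<longlonglongrightarrow> H w" for w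
    unfolding \<Delta>_def H t_def N(2)[symmetric] by (intro wick_mixed_difference_tendsto N(1) sym \<epsilon>)
  define K where "K = fact n * exp ((n + 1) * (1 + (\<Sum>i\<in>N. \<Sum>j\<in>N. \<bar>b i j\<bar>)))"
  \<comment> \<open>\<open>G\<close> dominates all the quotients at once, and its square is again an
    exponential with a known finite integral.\<close>
  define G where "G = (\<lambda>w. K * exp ((n + 1) * (\<Sum>i\<in>N. \<bar>X w i\<bar>)))"
  have \<Delta>G: "\<bar>\<Delta> k w\<bar> \<le> G w" for k w
    unfolding \<Delta>_def G_def K_def t_def N(2)[symmetric]
    by (intro abs_wick_mixed_difference_le N(1) sym \<epsilon>)
  have HG: "\<bar>H w\<bar> \<le> G w" for w
    by (rule LIMSEQ_le_const2[OF tendsto_rabs[OF \<Delta>H]]) (use \<Delta>G in blast)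
  have G2: "integrable P (\<lambda>w. (G w)\<^sup>2)"
  proof -
    have "(G w)\<^sup>2 = K\<^sup>2 * exp (2 * real (n + 1) * (\<Sum>i\<in>N. \<bar>W (f i) w\<bar>))" for w
      unfolding G_def X_def by (simp add: power_mult_distrib exp_double[symmetric] mult.assoc)
    then show ?thesis
      by (simp only:) (intro integrable_mult_right white_noise_integrable_exp_sum[OF W N(1)] fN)
  qed
  have Hm [measurable]: "H \<in> borel_measurable P"
  proof -
    have "(\<lambda>w. \<Delta> k w) \<in> borel_measurable P" for k
      unfolding \<Delta>_def wick_exp_def by measurable
    then show ?thesis by (rule borel_measurable_LIMSEQ_real[OF \<Delta>H])
  qed
  have "integrable P (\<lambda>w. (H w)\<^sup>2)"
  proof (rule Bochner_Integration.integrable_bound[OF G2])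
    have "(H w)\<^sup>2 \<le> (G w)\<^sup>2" for w
      using HG[of w] by (rule abs_le_square_iff[THEN iffD1, OF order_trans[OF _ abs_ge_self]])
    then show "AE w in P. norm ((H w)\<^sup>2) \<le> norm ((G w)\<^sup>2)"
      by simp
  qed measurable
  then have HL2: "(\<lambda>w. complex_of_real (H w)) \<in> L2 P"
    by (simp add: L2_def)
  have conv: "(\<lambda>k. \<integral>w. (norm (complex_of_real (H w) - D k w))\<^sup>2 \<partial>P) \<longlonglongrightarrow> 0"
  proof -
    have "(\<lambda>k. \<integral>w. (norm (complex_of_real (H w) - D k w))\<^sup>2 \<partial>P) \<longlonglongrightarrow> (\<integral>w. 0 \<partial>P)"
    \<comment> \<open>Both \<open>H\<close> and the quotients are bounded by \<open>G\<close>, so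
      their difference is at most \<open>2 * G w\<close>, whose square is the dominating
      function.\<close>
    proof (rule integral_dominated_convergence[where w = "\<lambda>w. 4 * (G w)\<^sup>2"])
      show "(\<lambda>w. (norm (complex_of_real (H w) - D k w))\<^sup>2) \<in> borel_measurable P" for k
      proof -
        have [measurable]: "D k \<in> borel_measurable P"
          using DL2[of k] by (simp add: L2_def)
        show ?thesis by measurable
      qed
      show "integrable P (\<lambda>w. 4 * (G w)\<^sup>2)"
        using G2 by simp
      have all: "AE w in P. \<forall>k. D k w = complex_of_real (\<Delta> k w)"
        unfolding AE_all_countable using D\<Delta> by blast
      then show "AE w in P. (\<lambda>k. (norm (complex_of_real (H w) - D k w))\<^sup>2) \<longlonglongrightarrow> 0"
      proof eventually_elim
        case (elim w)
        have "(\<lambda>k. (norm (complex_of_real (H w) - complex_of_real (\<Delta> k w)))\<^sup>2) \<longlonglongrightarrow>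
            (norm (complex_of_real (H w) - complex_of_real (H w)))\<^sup>2"
          by (intro tendsto_intros \<Delta>H)
        with elim show ?case by simp
      qed
      show "AE w in P. norm ((norm (complex_of_real (H w) - D k w))\<^sup>2) \<le> 4 * (G w)\<^sup>2" for k
        using all
      proof eventually_elim
        case (elim w)
        have "norm (complex_of_real (H w) - D k w) = \<bar>H w - \<Delta> k w\<bar>"
          using elim by (metis norm_of_real of_real_diff)
        also have "\<dots> \<le> 2 * G w"
          using HG[of w] \<Delta>G[of k w] by linarith
        finally have "(norm (complex_of_real (H w) - D k w))\<^sup>2 \<le> (2 * G w)\<^sup>2"
          by (intro power_mono) auto
        then show ?case by (simp add: power_mult_distrib)
      qed
    qed simp
    then show ?thesis by simp
  qed

  \<comment> \<open>Poisson side: almost sure convergence to the Charlier functional\<close>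
  have "AE \<omega> in Q. \<Phi> (\<lambda>w. complex_of_real (E k S w)) \<omega> = complex_of_real (poisson_exp N \<omega> f m (t k S))" for k S
  proof -
    have "(\<integral>x. h k S x \<partial>M) = (\<Sum>i\<in>N. m i * t k S i)"
      unfolding h_def m_def using fN
      by (subst Bochner_Integration.integral_sum) (auto intro!: L2_integrable simp: mult.commute)
    moreover have "h k S x = (\<Sum>i\<in>N. f i x * t k S i)" for x
      by (simp add: h_def mult.commute)
    ultimately show ?thesis
      using assms(5)[OF hL2, of k S] by (simp add: E_def poisson_exp_def)
  qed
  then have poisson: "AE \<omega> in Q. \<forall>S \<in> Pow N. \<Phi> (\<lambda>w. complex_of_real (E k S w)) \<omega> =
      complex_of_real (poisson_exp N \<omega> f m (t k S))" for k
    using N by (intro AE_finite_allI) auto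
  have sum: "AE \<omega> in Q. \<Phi> (D k) \<omega> =
      (\<Sum>S \<in> Pow N. complex_of_real (c k S) * \<Phi> (\<lambda>w. complex_of_real (E k S w)) \<omega>)" for k
    unfolding D_def using N EL2 by (intro L2_isometry_sum[OF \<Phi>]) auto
  have "AE \<omega> in Q. \<Phi> (D k) \<omega> = complex_of_real
      ((\<Sum>S \<in> Pow N. (-1) ^ card (N - S) * poisson_exp N \<omega> f m (t k S)) / \<epsilon> k ^ n)" for k
    using poisson[of k] sum[of k] by eventually_elim (simp add: c_def sum_divide_distrib)
  \<comment> \<open>Countably many null sets are merged, so one exceptional set serves the whole
    sequence.\<close>
  then have "AE \<omega> in Q. \<forall>k. \<Phi> (D k) \<omega> = complex_of_real
      ((\<Sum>S \<in> Pow N. (-1) ^ card (N - S) * poisson_exp N \<omega> f m (t k S)) / \<epsilon> k ^ n)"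
    unfolding AE_all_countable by blast
  then have lim: "AE \<omega> in Q. (\<lambda>k. \<Phi> (D k) \<omega>) \<longlonglongrightarrow> complex_of_real (C \<omega>)"
    using AE_space
  proof eventually_elim
    case (elim \<omega>)
    have "finite \<omega>" using elim(2) space_poisson[OF Q] by (simp add: configurations_def)
    from poisson_mixed_difference_tendsto[OF N(1) this \<epsilon>(1,2), of f m]
    have "(\<lambda>k. (\<Sum>S \<in> Pow N. (-1) ^ card (N - S) * poisson_exp N \<omega> f m (t k S)) / \<epsilon> k ^ n) \<longlonglongrightarrow> C \<omega>"
      unfolding C_def charlier_functional_eq_cycle_sum t_def m_def N(2) unfolding N_def .
    then show ?case
      unfolding elim(1)[rule_format] by (rule tendsto_of_real)
  qed
  have eq: "AE \<omega> in Q. \<Phi> (\<lambda>w. complex_of_real (H w)) \<omega> = complex_of_real (C \<omega>)"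
    by (rule L2_isometry_limit[OF \<Phi> HL2 DL2 conv lim])
  have Cm: "C \<in> borel_measurable Q"
    unfolding C_def using f by (intro charlier_functional_measurable[OF Q]) (simp add: L2_def)
  have "\<Phi> (\<lambda>w. complex_of_real (H w)) \<in> L2 Q"
    using \<Phi> HL2 unfolding L2_isometry_def by blast
  then have "integrable Q (\<lambda>\<omega>. (norm (\<Phi> (\<lambda>w. complex_of_real (H w)) \<omega>))\<^sup>2)"
    by (simp add: L2_def)
  \<comment> \<open>Square integrability of the Charlier functional is inherited from the image of
    the Hermite functional, with which it agrees almost everywhere.\<close>
  then have "integrable Q (\<lambda>\<omega>. (norm (complex_of_real (C \<omega>)))\<^sup>2)"
    by (rule integrable_cong_AE_imp) (use Cm eq in auto)
  then have "(\<lambda>\<omega>. complex_of_real (C \<omega>)) \<in> L2 Q"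
    using Cm by (simp add: L2_def)
  with HL2 eq show ?thesis
    unfolding H_def C_def by blast
qed

end
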